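(* Let $n\ge1$ and $s\in(0,1)$. For $t>0$ and $x\in\mathbb{R}^n$ let $$\mathcal{H}(x,t):=\int_{\mathbb{R}^n}e^{-t(|\xi|^2+|\xi|^{2s})+2\pi i x\cdot\xi}\,d\xi.$$ Then: (i) $\mathcal{H}$ is nonnegative, radially symmetric in $x$ and nonincreasing with respect to $r=|x|$. (ii) There exist positive constants $C_1$ and $C_2$ such that $$\mathcal{H}(x,t)\le C_1\left\{\frac{t}{|x|^{n+2s}}\vee\frac{t^s}{|x|^{n+2s}}\right\}\wedge\left\{t^{-\frac n{2s}}\wedge t^{-\frac n2}\right\}$$ and $$\mathcal{H}(x,t)\ge C_2\begin{cases}\dfrac{t}{|x|^{n+2s}}&\text{if }1<t<|x|^{2s},\\[2mm] e^{-\frac{\pi|x|^2}{t}}\,t^{-\frac n2}&\text{if }|x|^2<t<|x|^{2s}<1.\end{cases}$$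
   Context: $a\wedge b:=\min\{a,b\}$ and $a\vee b:=\max\{a,b\}$. When $x=0$ the quantities $t/|x|^{n+2s}$ and $t^s/|x|^{n+2s}$ are read as $+\infty$. The constants $C_1,C_2$ do not depend on $x$ and $t$. *)

theory Defs
  imports "HOL-Analysis.Analysis"
begin

text \<open>
  The kernel is complex valued by definition; that its values are real is part of
  what has to be shown. The dimension is \<open>n = CARD('n)\<close>.
\<close>

definition heat_kernel :: "real \<Rightarrow> real ^ 'n \<Rightarrow> real \<Rightarrow> complex" where
  "heat_kernel s x t =
    (\<integral>\<xi>. exp (complex_of_real (- t * ((norm \<xi>)\<^sup>2 + norm \<xi> powr (2 * s)))
               + 2 * complex_of_real pi * \<i> * complex_of_real (x \<bullet> \<xi>)) \<partial>lborel)"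

text \<open>
  The two bounds below are extended reals because at \<open>x = 0\<close> they are to be read as
  \<open>+\<infinity>\<close>; this is what \<^typ>\<open>ereal\<close> division of a positive number by \<open>0\<close> gives.
\<close>

definition tail_bound :: "real \<Rightarrow> real ^ 'n \<Rightarrow> real \<Rightarrow> ereal" where
  "tail_bound s x t =
    max (ereal t / ereal (norm x powr (real CARD('n) + 2 * s)))
        (ereal (t powr s) / ereal (norm x powr (real CARD('n) + 2 * s)))"

lemma tail_bound_zero: "t > 0 \<Longrightarrow> tail_bound s (0 :: real ^ 'n) t = \<infinity>"
  by (simp add: tail_bound_def)

end

theory Submission imports Defs "HOL-Probability.Probability" begin

text \<open>
  The function \<open>exp (- t u\<^sup>s)\<close> is a pointwise limit of nonnegative combinations of the
  exponentials \<open>exp (- l u)\<close>. Putting \<open>u = |\<xi>|\<^sup>2\<close>, the kernel is correspondingly a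
  limit of nonnegative combinations of Gaussians \<open>G(x, t + l)\<close>, so it is nonnegative, radial and
  nonincreasing. A bound of \<open>G(x, t + l)\<close>, for all \<open>l \<ge> 0\<close>, by a fixed combination of exponentials
  \<open>\<Sum>i. c\<^sub>i exp (- l u\<^sub>i)\<close> passes to the limit and bounds the kernel by
  \<open>\<Sum>i. c\<^sub>i exp (- t u\<^sub>i\<^sup>s)\<close>. All the estimates are of this kind, except the
  one by \<open>t\<close> to the power \<open>- n / (2 s)\<close>, which comes from the integral of the modulus. The stable
  subordinator never has to be constructed.
\<close>

text \<open>The hard estimate is the lower tail bound. Relative to |x|^(-n),
  \<open>gaussian_fourier (t + l) x\<close> is exponentially small when t + l is far below |x|^2, so
  a minorant built from exponentials in l should be nonpositive for small l; yet once exp (- l u)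
  becomes exp (- t u^s) it must stay positive to first order in t. A second difference at a, 2a, 3a
  vanishes to second order at l = 0, and subtracting \<delta> times a first difference makes it
  nonpositive near 0; strict concavity of u^s keeps the first-order term in t positive when \<delta>
  is small. The constants \<open>D\<close>, \<open>\<delta>\<close>, \<open>K\<close> and
  \<open>\<epsilon>0\<close> come from this balance. Such comparison combinations may have
  coefficients of either sign; only the mixture needs nonnegative ones. The factor exp (- t |xi|^2)
  is kept outside the mixture: it supplies integrability and dominates every limit under the
  integral. For the second lower bound |x|^2 < t, so exp (- pi |x|^2 / t) and exp (- pi^2 |x|^2 / t)
  are both comparable to 1, and the mismatch of pi and pi^2 costs only a constant.\<close>

section \<open>Mixtures of exponentials\<close>

text \<open>On u >= 0 these are the Laplace transforms of finite measures, up to a jump at u = 0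
  caused by mass escaping to l = infinity. The inductive form replaces the measure by an induction
  principle.\<close>

inductive exp_mixture :: "(real \<Rightarrow> real) \<Rightarrow> bool" where
  exponential: "0 \<le> l \<Longrightarrow> exp_mixture (\<lambda>u. exp (- (l * u)))"
| add: "exp_mixture f \<Longrightarrow> exp_mixture g \<Longrightarrow> exp_mixture (\<lambda>u. f u + g u)"
| scale: "0 \<le> c \<Longrightarrow> exp_mixture f \<Longrightarrow> exp_mixture (\<lambda>u. c * f u)"
| limit: "(\<And>n. exp_mixture (F n)) \<Longrightarrow> (\<And>u. 0 \<le> u \<Longrightarrow> (\<lambda>n::nat. F n u) \<longlonglongrightarrow> f u) \<Longrightarrow> exp_mixture f"

lemma exp_mixture_bounds:
  assumes "exp_mixture f" "0 \<le> u"
  shows "0 \<le> f u" "f u \<le> f 0"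
proof -
  from assms have "0 \<le> f u \<and> f u \<le> f 0"
  proof (induction)
    case (limit F f)
    have "0 \<le> f u"
      by (rule LIMSEQ_le_const[OF limit(2)]) (use limit in auto)
    moreover have "f u \<le> f 0"
      by (rule LIMSEQ_le[OF limit(2) limit(2)]) (use limit in auto)
    ultimately show ?case by simp
  qed (auto intro: add_mono mult_left_mono)
  then show "0 \<le> f u" "f u \<le> f 0" by auto
qed

lemma exp_mixture_borel:
  assumes "exp_mixture f"
  shows "(\<lambda>\<xi>::'a::euclidean_space. f ((norm \<xi>)\<^sup>2)) \<in> borel_measurable borel"
  using assms
proof (induction)
  case (limit F f)
  show ?case
    by (rule borel_measurable_LIMSEQ_real[where u = "\<lambda>n \<xi>. F n ((norm \<xi>)\<^sup>2)"])
       (use limit in auto)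
qed auto

text \<open>Exponents of two exponentials add; every other rule, for either factor, commutes with
  multiplication by the other factor held fixed. Hence one induction nested in another.\<close>

lemma exp_mixture_mult:
  assumes "exp_mixture f" "exp_mixture g"
  shows "exp_mixture (\<lambda>u. f u * g u)"
  using assms(1)
proof (induction)
  case (exponential l)
  from assms(2) show ?case
  proof (induction)
    case (exponential m)
    then show ?case
      using exp_mixture.exponential[of "l + m"] \<open>0 \<le> l\<close>
      by (simp add: exp_add[symmetric] algebra_simps)
  next
    case (add f g)
    then show ?case using exp_mixture.add by (simp add: distrib_left)
  next
    case (scale c f)
    then show ?case using exp_mixture.scale by (simp add: mult.left_commute)
  next
    case (limit F f)
    show ?case
      by (rule exp_mixture.limit[where F = "\<lambda>n u. exp (- (l * u)) * F n u"])
         (use limit in \<open>auto intro: tendsto_mult\<close>)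
  qed
next
  case (add f g)
  then show ?case using exp_mixture.add by (simp add: distrib_right)
next
  case (scale c f)
  then show ?case using exp_mixture.scale by (simp add: mult.assoc)
next
  case (limit F f)
  show ?case
    by (rule exp_mixture.limit[where F = "\<lambda>n u. F n u * g u"])
       (use limit in \<open>auto intro: tendsto_mult\<close>)
qed

lemma exp_mixture_const: "0 \<le> c \<Longrightarrow> exp_mixture (\<lambda>u. c)"
  using exp_mixture.scale[OF _ exp_mixture.exponential[of 0], of c] by simp

lemma exp_mixture_power: "exp_mixture f \<Longrightarrow> exp_mixture (\<lambda>u. f u ^ k)"
  by (induction k) (auto intro: exp_mixture_const exp_mixture_mult)

lemma exp_mixture_sum:
  assumes "\<And>k. exp_mixture (f k)"
  shows "exp_mixture (\<lambda>u. \<Sum>k<(n::nat). f k u)"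
  by (induction n) (auto intro: exp_mixture_const exp_mixture.add assms)

text \<open>The exponential series has nonnegative coefficients.\<close>

lemma exp_mixture_exp:
  assumes "exp_mixture f"
  shows "exp_mixture (\<lambda>u. exp (f u))"
proof (rule exp_mixture.limit)
  show "exp_mixture (\<lambda>u. \<Sum>k<n. inverse (fact k) * f u ^ k)" for n
    by (intro exp_mixture_sum exp_mixture.scale exp_mixture_power assms) simp
  show "(\<lambda>n. \<Sum>k<n. inverse (fact k) * f u ^ k) \<longlonglongrightarrow> exp (f u)" for u
    using exp_converges[of "f u"] by (simp add: sums_def)
qed

section \<open>Laplace exponents (Bernstein functions)\<close>

text \<open>Modelled on Schoenberg's characterization of Bernstein functions. Taken as a definition,
  it reduces closure under sums, scaling and limits to closure properties of mixtures.\<close>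

definition laplace_exponent :: "(real \<Rightarrow> real) \<Rightarrow> bool" where
  "laplace_exponent \<phi> \<longleftrightarrow> (\<forall>c\<ge>0. exp_mixture (\<lambda>u. exp (- (c * \<phi> u))))"

text \<open>The compound Poisson case with jumps of size \<open>l\<close>: exp (- c (1 - e)) = exp
  (- c) exp (c e), where e is itself an exponential.\<close>

lemma laplace_exponent_one_minus_exp:
  assumes "0 \<le> l"
  shows "laplace_exponent (\<lambda>u. 1 - exp (- (l * u)))"
  unfolding laplace_exponent_def
proof (intro allI impI)
  fix c :: real assume "0 \<le> c"
  then have "exp_mixture (\<lambda>u. exp (- c) * exp (c * exp (- (l * u))))"
    by (intro exp_mixture.scale exp_mixture_exp exp_mixture.exponential assms) auto
  then show "exp_mixture (\<lambda>u. exp (- (c * (1 - exp (- (l * u))))))"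
    by (simp add: exp_add[symmetric] algebra_simps)
qed

lemma laplace_exponent_add:
  assumes "laplace_exponent \<phi>" "laplace_exponent \<psi>"
  shows "laplace_exponent (\<lambda>u. \<phi> u + \<psi> u)"
  unfolding laplace_exponent_def
proof (intro allI impI)
  fix c :: real assume "0 \<le> c"
  with assms have "exp_mixture (\<lambda>u. exp (- (c * \<phi> u)) * exp (- (c * \<psi> u)))"
    unfolding laplace_exponent_def by (intro exp_mixture_mult) auto
  then show "exp_mixture (\<lambda>u. exp (- (c * (\<phi> u + \<psi> u))))"
    by (simp add: exp_add[symmetric] algebra_simps)
qed

lemma laplace_exponent_scale:
  assumes "laplace_exponent \<phi>" "0 \<le> a"
  shows "laplace_exponent (\<lambda>u. a * \<phi> u)"
  unfolding laplace_exponent_def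
proof (intro allI impI)
  fix c :: real assume "0 \<le> c"
  with assms have "exp_mixture (\<lambda>u. exp (- ((c * a) * \<phi> u)))"
    unfolding laplace_exponent_def by simp
  then show "exp_mixture (\<lambda>u. exp (- (c * (a * \<phi> u))))"
    by (simp add: mult.assoc)
qed

lemma laplace_exponent_limit:
  assumes "\<And>n. laplace_exponent (F n)" "\<And>u. 0 \<le> u \<Longrightarrow> (\<lambda>n::nat. F n u) \<longlonglongrightarrow> f u"
  shows "laplace_exponent f"
  unfolding laplace_exponent_def
proof (intro allI impI)
  fix c :: real assume c: "0 \<le> c"
  show "exp_mixture (\<lambda>u. exp (- (c * f u)))"
    by (rule exp_mixture.limit[where F = "\<lambda>n u. exp (- (c * F n u))"])
       (use assms c in \<open>auto simp: laplace_exponent_def intro!: tendsto_intros\<close>)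
qed

lemma laplace_exponent_suminf:
  assumes "\<And>k. laplace_exponent (f k)" "\<And>u. 0 \<le> u \<Longrightarrow> summable (\<lambda>k::nat. f k u)"
  shows "laplace_exponent (\<lambda>u. \<Sum>k. f k u)"
proof (rule laplace_exponent_limit)
  show "laplace_exponent (\<lambda>u. \<Sum>k<n. f k u)" for n
  proof (induction n)
    case 0
    show ?case by (simp add: laplace_exponent_def exp_mixture_const)
  next
    case (Suc n)
    then show ?case using laplace_exponent_add[OF Suc assms(1)] by simp
  qed
  show "(\<lambda>n. \<Sum>k<n. f k u) \<longlonglongrightarrow> (\<Sum>k. f k u)" if "0 \<le> u" for u
    using summable_LIMSEQ[OF assms(2)[OF that]] .
qed

section \<open>Approximation of the power \<open>u powr s\<close>\<close>

text \<open>
  A discrete version of \<open>u\<^sup>s = C \<integral> (1 - exp (- l u)) l\<^bsup>-1-s\<^esup> dl\<close>, with \<open>l\<close> running through the powers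
  of \<open>exp h\<close>. It satisfies the scaling law of \<open>u\<^sup>s\<close> exactly for the factor \<open>exp h\<close>, and
  monotonicity in \<open>u\<close> controls the error in between.
\<close>

definition geometric_sum :: "real \<Rightarrow> real \<Rightarrow> real \<Rightarrow> real" where
  "geometric_sum s h u =
     (\<Sum>k. exp (- (s * h * real k)) * (1 - exp (- (exp (h * real k) * u)))) +
     (\<Sum>k. exp (s * h * real (Suc k)) * (1 - exp (- (exp (- (h * real (Suc k))) * u))))"

context
  fixes s h :: real
  assumes s: "0 < s" "s < 1" and h: "0 < h"
begin

text \<open>Both ends of the range of s are used. For large l, 1 - exp (- l u) <= 1 leaves the ratio
  exp (- s h); for small l, 1 - exp (- l u) <= l u leaves the ratio exp (- (1 - s) h).\<close>

lemma geometric_sum_summable: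
  assumes "0 \<le> u"
  shows "summable (\<lambda>k. exp (- (s * h * real k)) * (1 - exp (- (exp (h * real k) * u))))"
    and "summable (\<lambda>k. exp (s * h * real (Suc k)) * (1 - exp (- (exp (- (h * real (Suc k))) * u))))"
proof -
  show "summable (\<lambda>k. exp (- (s * h * real k)) * (1 - exp (- (exp (h * real k) * u))))"
  proof (rule summable_comparison_test')
    show "summable (\<lambda>k. exp (- (s * h)) ^ k)"
      using s h by (intro summable_geometric) simp
    show "norm (exp (- (s * h * real k)) * (1 - exp (- (exp (h * real k) * u)))) \<le> exp (- (s * h)) ^ k" for k
      using assms by (simp add: exp_of_nat_mult[symmetric] abs_mult mult.commute)
  qed
  show "summable (\<lambda>k. exp (s * h * real (Suc k)) * (1 - exp (- (exp (- (h * real (Suc k))) * u))))"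
  proof (rule summable_comparison_test')
    show "summable (\<lambda>k. u * exp (- ((1 - s) * h)) ^ Suc k)"
      using s h by (intro summable_mult summable_Suc_iff[THEN iffD2] summable_geometric) simp
    fix k
    let ?a = "exp (- (h * real (Suc k))) * u"
    have a: "0 \<le> ?a" using assms by simp
    then have "\<bar>1 - exp (- ?a)\<bar> \<le> ?a"
      using exp_ge_add_one_self[of "- ?a"] by (simp add: abs_if)
    then have "norm (exp (s * h * real (Suc k)) * (1 - exp (- ?a))) \<le> exp (s * h * real (Suc k)) * ?a"
      by (simp add: abs_mult del: of_nat_Suc)
    also have "\<dots> = u * exp (- ((1 - s) * h)) ^ Suc k"
      unfolding exp_of_nat_mult[symmetric] by (simp add: exp_add[symmetric] algebra_simps del: of_nat_Suc)
    finally show "norm (exp (s * h * real (Suc k)) * (1 - exp (- ?a))) \<le> u * exp (- ((1 - s) * h)) ^ Suc k" .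
  qed
qed

lemma geometric_sum_shift:
  assumes "0 \<le> u"
  shows "geometric_sum s h (exp h * u) = exp (s * h) * geometric_sum s h u"
proof -
  define P where "P = (\<lambda>u k. exp (- (s * h * real k)) * (1 - exp (- (exp (h * real k) * u))))"
  define M where "M = (\<lambda>u k. exp (s * h * real (Suc k)) * (1 - exp (- (exp (- (h * real (Suc k))) * u))))"
  have geo: "geometric_sum s h u = suminf (P u) + suminf (M u)" for u
    by (simp add: geometric_sum_def P_def M_def)
  have sP: "summable (P u)" and sM: "summable (M u)" and sM': "summable (M (exp h * u))"
    using geometric_sum_summable assms by (simp_all add: P_def M_def)
  have e: "exp a * (exp b * v) = exp (a + b) * v" for a b v :: real
    by (simp add: exp_add)
  have "P (exp h * u) = (\<lambda>k. exp (s * h) * P u (Suc k))"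
    unfolding P_def e by (simp add: algebra_simps)
  then have "suminf (P (exp h * u)) = exp (s * h) * (\<Sum>k. P u (Suc k))"
    using sP by (simp add: suminf_mult summable_Suc_iff)
  also have "(\<Sum>k. P u (Suc k)) = suminf (P u) - P u 0"
    using suminf_split_head[OF sP] .
  finally have 1: "suminf (P (exp h * u)) = exp (s * h) * (suminf (P u) - P u 0)" .
  have "(\<lambda>k. M (exp h * u) (Suc k)) = (\<lambda>k. exp (s * h) * M u k)"
    unfolding M_def e by (simp add: algebra_simps)
  then have "suminf (M (exp h * u)) - M (exp h * u) 0 = exp (s * h) * suminf (M u)"
    using sM suminf_split_head[OF sM'] by (simp add: suminf_mult)
  \<comment> \<open>Rescaling u shifts the index of the two-sided sum by one: the term lost at the
    head of \<open>P\<close> reappears as the head of \<open>M\<close>.\<close>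
  moreover have "M (exp h * u) 0 = exp (s * h) * P u 0"
    unfolding M_def P_def e by simp
  ultimately show ?thesis
    using 1 by (simp add: geo algebra_simps)
qed

lemma geometric_sum_shift_nat:
  assumes "0 \<le> u"
  shows "geometric_sum s h (exp (h * real m) * u) = exp (s * h * real m) * geometric_sum s h u"
proof (induction m)
  case (Suc m)
  have "geometric_sum s h (exp (h * real (Suc m)) * u) = geometric_sum s h (exp h * (exp (h * real m) * u))"
    by (simp add: exp_add distrib_left mult.assoc mult.left_commute)
  also have "\<dots> = exp (s * h) * (exp (s * h * real m) * geometric_sum s h u)"
    using assms by (simp add: geometric_sum_shift Suc)
  finally show ?case
    by (simp add: exp_add distrib_left)
qed simp

lemma geometric_sum_exp:
  "geometric_sum s h (exp (h * real_of_int m)) = exp (s * h * real_of_int m) * geometric_sum s h 1"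
proof (cases "0 \<le> m")
  case True
  then show ?thesis
    using geometric_sum_shift_nat[of 1 "nat m"] by simp
next
  case False
  have "geometric_sum s h 1 = geometric_sum s h (exp (h * real (nat (- m))) * exp (h * real_of_int m))"
    using False by (simp add: exp_add[symmetric])
  also have "\<dots> = exp (s * h * real (nat (- m))) * geometric_sum s h (exp (h * real_of_int m))"
    by (rule geometric_sum_shift_nat) simp
  finally show ?thesis
    using False by (simp add: exp_minus field_simps)
qed

lemma geometric_sum_mono:
  assumes "0 \<le> u" "u \<le> v"
  shows "geometric_sum s h u \<le> geometric_sum s h v"
  unfolding geometric_sum_def
  using assms by (intro add_mono suminf_le geometric_sum_summable) (auto intro!: mult_left_mono)

lemma geometric_sum_pos: "0 < geometric_sum s h 1"
  unfolding geometric_sum_def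
  by (intro add_pos_pos suminf_pos geometric_sum_summable) auto

text \<open>u lies between two consecutive powers of exp h, where the normalized sum equals the s-th
  power exactly; being off by one step costs at most a factor exp (s h).\<close>

lemma geometric_sum_bounds:
  assumes "0 < u"
  shows "u powr s * exp (- (s * h)) \<le> geometric_sum s h u / geometric_sum s h 1"
    and "geometric_sum s h u / geometric_sum s h 1 \<le> u powr s * exp (s * h)"
proof -
  define m where "m = \<lfloor>ln u / h\<rfloor>"
  have "real_of_int m \<le> ln u / h" "ln u / h \<le> real_of_int (m + 1)"
    unfolding m_def by linarith+
  then have m: "h * real_of_int m \<le> ln u" "ln u \<le> h * real_of_int (m + 1)"
    using h by (simp_all add: field_simps)
  have "exp (h * real_of_int m) \<le> exp (ln u)" "exp (ln u) \<le> exp (h * real_of_int (m + 1))"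
    using m by (simp_all del: exp_ln)
  then have e: "exp (h * real_of_int m) \<le> u" "u \<le> exp (h * real_of_int (m + 1))"
    using assms by simp_all
  have "s * ln u \<le> s * (h * real_of_int (m + 1))" "s * (h * real_of_int m) \<le> s * ln u"
    using m s by (intro mult_left_mono; simp)+
  then have p: "u powr s * exp (- (s * h)) \<le> exp (s * h * real_of_int m)"
      "exp (s * h * real_of_int (m + 1)) \<le> u powr s * exp (s * h)"
    using assms by (simp_all add: powr_def exp_add[symmetric] algebra_simps)
  have "exp (s * h * real_of_int m) * geometric_sum s h 1 \<le> geometric_sum s h u"
    unfolding geometric_sum_exp[symmetric] by (intro geometric_sum_mono e) simp
  moreover have "geometric_sum s h u \<le> exp (s * h * real_of_int (m + 1)) * geometric_sum s h 1"
    unfolding geometric_sum_exp[symmetric] using assms by (intro geometric_sum_mono e) simp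
  ultimately show "u powr s * exp (- (s * h)) \<le> geometric_sum s h u / geometric_sum s h 1"
    and "geometric_sum s h u / geometric_sum s h 1 \<le> u powr s * exp (s * h)"
    using p geometric_sum_pos by (simp_all add: pos_le_divide_eq pos_divide_le_eq)
       (meson order.trans mult_right_mono less_imp_le)+
qed

lemma laplace_exponent_geometric_sum: "laplace_exponent (geometric_sum s h)"
  unfolding geometric_sum_def
  by (intro laplace_exponent_add laplace_exponent_suminf geometric_sum_summable
        laplace_exponent_scale laplace_exponent_one_minus_exp) auto

end

lemma laplace_exponent_powr:
  assumes "0 < s" "s < 1"
  shows "laplace_exponent (\<lambda>u. u powr s)"
proof (rule laplace_exponent_limit)
  define h where "h = (\<lambda>n::nat. 1 / real (Suc n))"
  have h: "0 < h n" for n by (simp add: h_def)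
  have h0: "h \<longlonglongrightarrow> 0"
    unfolding h_def by (rule LIMSEQ_Suc[OF lim_1_over_n])
  show "laplace_exponent (\<lambda>u. 1 / geometric_sum s (h n) 1 * geometric_sum s (h n) u)" for n
    using geometric_sum_pos[OF assms h] by (intro laplace_exponent_scale laplace_exponent_geometric_sum assms h) 
      (simp add: less_imp_le)
  show "(\<lambda>n. 1 / geometric_sum s (h n) 1 * geometric_sum s (h n) u) \<longlonglongrightarrow> u powr s" if "0 \<le> u" for u
  \<comment> \<open>The sandwich takes logarithms of u, so u = 0 is separate; there every term of
    the sums is 0, as is \<open>0 powr s\<close>.\<close>
  proof (cases "u = 0")
    case True
    then show ?thesis by (simp add: geometric_sum_def)
  next
    case False
    with that have u: "0 < u" by simp
    show ?thesis
    proof (rule tendsto_sandwich)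
      have "(\<lambda>n. u powr s * exp (- (s * h n))) \<longlonglongrightarrow> u powr s * exp (- (s * 0))"
        by (intro tendsto_intros h0)
      then show "(\<lambda>n. u powr s * exp (- (s * h n))) \<longlonglongrightarrow> u powr s" by simp
      have "(\<lambda>n. u powr s * exp (s * h n)) \<longlonglongrightarrow> u powr s * exp (s * 0)"
        by (intro tendsto_intros h0)
      then show "(\<lambda>n. u powr s * exp (s * h n)) \<longlonglongrightarrow> u powr s" by simp
    qed (use geometric_sum_bounds[OF assms h u] in simp_all)
  qed
qed

section \<open>Fourier transform of the Gaussian\<close>

lemma integrable_gaussian:
  assumes "0 < a"
  shows "integrable lborel (\<lambda>y::real. exp (- (a * y\<^sup>2)))"
proof -
  define \<sigma> where "\<sigma> = 1 / sqrt (2 * a)"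
  have \<sigma>: "0 < \<sigma>" "\<sigma>\<^sup>2 = 1 / (2 * a)"
    using assms by (simp_all add: \<sigma>_def power_divide)
  have "(\<lambda>y. sqrt (2 * pi * \<sigma>\<^sup>2) * normal_density 0 \<sigma> y) = (\<lambda>y. exp (- (a * y\<^sup>2)))"
    using \<sigma> assms by (auto simp: normal_density_def fun_eq_iff real_sqrt_divide field_simps)
  then show ?thesis
    using integrable_mult_right[OF integrable_normal_density[OF \<sigma>(1), of 0], of "sqrt (2 * pi * \<sigma>\<^sup>2)"]
    by simp
qed

lemma integrable_gaussian_cis:
  assumes "0 < a"
  shows "integrable lborel (\<lambda>y. complex_of_real (exp (- (a * y\<^sup>2))) * cis (2 * pi * (b * y)))"
proof (rule Bochner_Integration.integrable_bound[OF integrable_gaussian[OF assms]])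
  show "(\<lambda>y. complex_of_real (exp (- (a * y\<^sup>2))) * cis (2 * pi * (b * y))) \<in> borel_measurable lborel"
    unfolding cis_conv_exp by measurable
qed (simp add: norm_mult)

text \<open>This is the characteristic function of the standard normal law after the substitution y
  -> c y, with \<open>c\<close> chosen so that a (c y)^2 = y^2 / 2.\<close>

lemma integral_gaussian_cis:
  assumes "0 < a"
  shows "(\<integral>y. complex_of_real (exp (- (a * y\<^sup>2))) * cis (2 * pi * (b * y)) \<partial>lborel)
           = complex_of_real (sqrt (pi / a) * exp (- (pi\<^sup>2 * b\<^sup>2 / a)))"
proof -
  define c where "c = 1 / sqrt (2 * a)"
  have c: "0 < c" "c\<^sup>2 = 1 / (2 * a)"
    using assms by (simp_all add: c_def power_divide)
  let ?T = "2 * pi * b * c"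
  have "complex_of_real (exp (- (?T\<^sup>2) / 2)) = char std_normal_distribution ?T"
    by (simp add: char_std_normal_distribution)
  also have "\<dots> = (\<integral>y. std_normal_density y *\<^sub>R iexp (?T * y) \<partial>lborel)"
    unfolding char_def by (subst integral_density) auto
  finally have 1: "(\<integral>y. std_normal_density y *\<^sub>R iexp (?T * y) \<partial>lborel) = complex_of_real (exp (- (?T\<^sup>2) / 2))"
    by simp
  have 2: "complex_of_real (exp (- (a * (0 + c * y)\<^sup>2))) * cis (2 * pi * (b * (0 + c * y)))
         = complex_of_real (sqrt (2 * pi)) * (std_normal_density y *\<^sub>R iexp (?T * y))" for y
  proof -
    have "a * (0 + c * y)\<^sup>2 = y\<^sup>2 / 2"
      using assms c by (simp add: power_mult_distrib)
    then have "exp (- (a * (0 + c * y)\<^sup>2)) = sqrt (2 * pi) * std_normal_density y"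
      by (simp add: std_normal_density_def)
    then show ?thesis
      by (simp only: of_real_mult) (simp add: cis_conv_exp scaleR_conv_of_real mult_ac)
  qed
  have "(\<integral>y. complex_of_real (exp (- (a * y\<^sup>2))) * cis (2 * pi * (b * y)) \<partial>lborel)
      = \<bar>c\<bar> *\<^sub>R (\<integral>y. complex_of_real (sqrt (2 * pi)) * (std_normal_density y *\<^sub>R iexp (?T * y)) \<partial>lborel)"
    by (subst lborel_integral_real_affine[where c = c and t = 0]) (use c in simp, simp only: 2)
  also have "\<dots> = complex_of_real (c * sqrt (2 * pi) * exp (- (?T\<^sup>2) / 2))"
    unfolding integral_mult_right_zero 1 using c by (simp add: scaleR_conv_of_real)
  also have "c * sqrt (2 * pi) = sqrt (pi / a)"
    unfolding c_def by (simp add: real_sqrt_divide real_sqrt_mult)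
  also have "- (?T\<^sup>2) / 2 = - (pi\<^sup>2 * b\<^sup>2 / a)"
    using c assms by (simp add: power_mult_distrib)
  finally show ?thesis .
qed

text \<open>The G(x, a) of the overview, for the convention with 2 pi in the phase.\<close>

definition gaussian_fourier :: "real \<Rightarrow> 'a::euclidean_space \<Rightarrow> real" where
  "gaussian_fourier a x = sqrt (pi / a) ^ DIM('a) * exp (- (pi\<^sup>2 * (norm x)\<^sup>2 / a))"

lemma norm_power2_Basis: "(norm (x::'a::euclidean_space))\<^sup>2 = (\<Sum>b\<in>Basis. (x \<bullet> b)\<^sup>2)"
  unfolding power2_norm_eq_inner by (subst euclidean_inner) (simp add: power2_eq_square)

text \<open>The integrand is a product over coordinates and \<open>lborel\<close> is the image of a
  product of one-dimensional Lebesgue measures, so Fubini reduces the claim to dimension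
  one.\<close>

lemma
  fixes x :: "'a::euclidean_space"
  assumes a: "0 < a"
  shows integrable_gaussian_euclidean_cis:
      "integrable lborel (\<lambda>\<xi>::'a. complex_of_real (exp (- (a * (norm \<xi>)\<^sup>2))) * cis (2 * pi * (x \<bullet> \<xi>)))"
    and integral_gaussian_euclidean_cis:
      "(\<integral>\<xi>. complex_of_real (exp (- (a * (norm \<xi>)\<^sup>2))) * cis (2 * pi * (x \<bullet> \<xi>)) \<partial>lborel)
         = complex_of_real (gaussian_fourier a x)"
proof -
  interpret product_sigma_finite "\<lambda>_::'a. lborel :: real measure" by standard
  define G where "G = (\<lambda>b y. complex_of_real (exp (- (a * y\<^sup>2))) * cis (2 * pi * ((x \<bullet> b) * y)))"
  define F where "F = (\<lambda>\<xi>::'a. complex_of_real (exp (- (a * (norm \<xi>)\<^sup>2))) * cis (2 * pi * (x \<bullet> \<xi>)))"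
  have F_eq: "F \<xi> = (\<Prod>b\<in>Basis. G b (\<xi> \<bullet> b))" for \<xi>
  proof -
    have "F \<xi> = exp (\<Sum>b\<in>Basis. complex_of_real (- (a * (\<xi> \<bullet> b)\<^sup>2)) + \<i> * complex_of_real (2 * pi * ((x \<bullet> b) * (\<xi> \<bullet> b))))"
      unfolding F_def cis_conv_exp exp_of_real[symmetric] exp_add[symmetric] norm_power2_Basis
      by (subst euclidean_inner[of x]) (simp add: sum.distrib sum_subtractf sum_distrib_left sum_negf mult_ac)
    also have "\<dots> = (\<Prod>b\<in>Basis. G b (\<xi> \<bullet> b))"
      by (subst exp_sum) (simp_all add: G_def cis_conv_exp exp_diff exp_minus exp_of_real[symmetric] field_simps)
    finally show ?thesis .
  qed
  have meas: "F \<in> borel_measurable borel"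
    unfolding F_def cis_conv_exp by measurable
  let ?e = "\<lambda>f::'a \<Rightarrow> real. \<Sum>b\<in>Basis. f b *\<^sub>R b"
  have e: "?e \<in> measurable (\<Pi>\<^sub>M b\<in>Basis. lborel) borel"
    by measurable
  have Fe: "F (?e f) = (\<Prod>b\<in>Basis. G b (f b))" for f
    by (simp add: F_eq inner_sum_left_Basis)
  have int: "integrable lborel (G b)" for b
    unfolding G_def by (rule integrable_gaussian_cis[OF a])
  have "integrable (\<Pi>\<^sub>M b\<in>Basis. lborel) (\<lambda>f. \<Prod>b\<in>Basis. G b (f b))"
    by (intro product_integrable_prod int) simp
  then have "integrable (distr (\<Pi>\<^sub>M b\<in>Basis. lborel) borel ?e) F"
    by (subst integrable_distr_eq[OF e meas]) (simp add: Fe)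
  then show "integrable lborel (\<lambda>\<xi>::'a. complex_of_real (exp (- (a * (norm \<xi>)\<^sup>2))) * cis (2 * pi * (x \<bullet> \<xi>)))"
    unfolding F_def lborel_eq[symmetric] .
  have "(\<integral>\<xi>. F \<xi> \<partial>lborel) = (\<integral>f. (\<Prod>b\<in>Basis. G b (f b)) \<partial>(\<Pi>\<^sub>M b\<in>Basis. lborel))"
    by (subst lborel_eq, subst integral_distr[OF e meas]) (simp add: Fe)
  also have "\<dots> = (\<Prod>b\<in>Basis. \<integral>y. G b y \<partial>lborel)"
    by (intro product_integral_prod int) simp
  also have "\<dots> = (\<Prod>b\<in>(Basis::'a set). complex_of_real (sqrt (pi / a) * exp (- (pi\<^sup>2 * (x \<bullet> b)\<^sup>2 / a))))"
    unfolding G_def by (simp only: integral_gaussian_cis[OF a])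
  also have "\<dots> = complex_of_real (gaussian_fourier a x)"
    unfolding gaussian_fourier_def norm_power2_Basis of_real_prod[symmetric]
    by (simp add: prod.distrib exp_sum[symmetric] sum_distrib_left sum_divide_distrib sum_negf)
  finally show "(\<integral>\<xi>. complex_of_real (exp (- (a * (norm \<xi>)\<^sup>2))) * cis (2 * pi * (x \<bullet> \<xi>)) \<partial>lborel)
         = complex_of_real (gaussian_fourier a x)"
    unfolding F_def .
qed

lemma integrable_gaussian_euclidean:
  assumes "0 < a"
  shows "integrable lborel (\<lambda>\<xi>::'a::euclidean_space. exp (- (a * (norm \<xi>)\<^sup>2)))"
  using integrable_norm[OF integrable_gaussian_euclidean_cis[OF assms, of 0]] by simp

section \<open>Fourier integrals as functionals of the mixture\<close>

definition damped_fourier :: "real \<Rightarrow> (real \<Rightarrow> real) \<Rightarrow> 'a::euclidean_space \<Rightarrow> complex" where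
  "damped_fourier t f x =
     (\<integral>\<xi>. complex_of_real (exp (- (t * (norm \<xi>)\<^sup>2)) * f ((norm \<xi>)\<^sup>2)) * cis (2 * pi * (x \<bullet> \<xi>)) \<partial>lborel)"

text \<open>No positivity is demanded, so differences of such functionals qualify; linearity and
  continuity are asked only along mixtures, where the Fourier integrals are under control.\<close>

definition mixture_functional :: "((real \<Rightarrow> real) \<Rightarrow> real) \<Rightarrow> bool" where
  "mixture_functional \<Psi> \<longleftrightarrow>
     (\<forall>f g. exp_mixture f \<longrightarrow> exp_mixture g \<longrightarrow> \<Psi> (\<lambda>u. f u + g u) = \<Psi> f + \<Psi> g) \<and>
     (\<forall>c f. 0 \<le> c \<longrightarrow> exp_mixture f \<longrightarrow> \<Psi> (\<lambda>u. c * f u) = c * \<Psi> f) \<and>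
     (\<forall>F f. (\<forall>n. exp_mixture (F n)) \<longrightarrow> exp_mixture f \<longrightarrow> (\<forall>u\<ge>0. (\<lambda>n::nat. F n u) \<longlonglongrightarrow> f u) \<longrightarrow>
        (\<lambda>n. \<Psi> (F n)) \<longlonglongrightarrow> \<Psi> f)"

text \<open>The transfer principle. To compare two functionals, \<open>\<Psi>\<close> is taken to be
  their difference, and what remains is a scalar inequality for every l >= 0.\<close>

lemma mixture_functional_nonneg:
  assumes "mixture_functional \<Psi>" "\<And>l. 0 \<le> l \<Longrightarrow> 0 \<le> \<Psi> (\<lambda>u. exp (- (l * u)))" "exp_mixture f"
  shows "0 \<le> \<Psi> f"
  using assms(3)
proof induction
  case (add f g)
  then show ?case using assms(1) by (simp add: mixture_functional_def)
next
  case (scale c f)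
  then show ?case using assms(1) by (simp add: mixture_functional_def)
next
  case (limit F f)
  then have "(\<lambda>n. \<Psi> (F n)) \<longlonglongrightarrow> \<Psi> f"
    using assms(1) exp_mixture.limit[of F f] unfolding mixture_functional_def by blast
  then show ?case by (rule LIMSEQ_le_const) (use limit in auto)
qed (use assms(2) in auto)

lemma mixture_functional_eval: "0 \<le> u \<Longrightarrow> mixture_functional (\<lambda>f. f u)"
  by (simp add: mixture_functional_def)

lemma mixture_functional_add:
  "mixture_functional \<Phi> \<Longrightarrow> mixture_functional \<Psi> \<Longrightarrow> mixture_functional (\<lambda>f. \<Phi> f + \<Psi> f)"
  unfolding mixture_functional_def by (auto simp: algebra_simps intro!: tendsto_add)

lemma mixture_functional_scale:
  "mixture_functional \<Psi> \<Longrightarrow> mixture_functional (\<lambda>f. c * \<Psi> f)"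
  unfolding mixture_functional_def by (auto simp: algebra_simps intro!: tendsto_mult)

lemma mixture_functional_diff:
  "mixture_functional \<Phi> \<Longrightarrow> mixture_functional \<Psi> \<Longrightarrow> mixture_functional (\<lambda>f. \<Phi> f - \<Psi> f)"
  using mixture_functional_add[of \<Phi>, OF _ mixture_functional_scale[of \<Psi> "-1"]] by simp

context
  fixes t :: real and x :: "'a::euclidean_space"
  assumes t: "0 < t"
begin

lemma damped_fourier_measurable:
  assumes "exp_mixture f"
  shows "(\<lambda>\<xi>::'a. complex_of_real (exp (- (t * (norm \<xi>)\<^sup>2)) * f ((norm \<xi>)\<^sup>2)) * cis (2 * pi * (x \<bullet> \<xi>)))
           \<in> borel_measurable lborel"
proof -
  have "(\<lambda>\<xi>::'a. cis (2 * pi * (x \<bullet> \<xi>))) \<in> borel_measurable borel"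
    unfolding cis_conv_exp by measurable
  moreover have "(\<lambda>\<xi>::'a. complex_of_real (exp (- (t * (norm \<xi>)\<^sup>2)))) \<in> borel_measurable borel"
    by measurable
  moreover have "(\<lambda>\<xi>::'a. complex_of_real (f ((norm \<xi>)\<^sup>2))) \<in> borel_measurable borel"
    by (rule measurable_compose[OF exp_mixture_borel[OF assms] borel_measurable_of_real])
  ultimately show ?thesis
    unfolding of_real_mult by (intro borel_measurable_times) simp_all
qed

lemma damped_fourier_norm_le:
  assumes "exp_mixture f"
  shows "norm (complex_of_real (exp (- (t * (norm \<xi>)\<^sup>2)) * f ((norm \<xi>)\<^sup>2)) * cis (2 * pi * (x \<bullet> \<xi>)))
           \<le> f 0 * exp (- (t * (norm \<xi>)\<^sup>2))"
  using exp_mixture_bounds[OF assms, of "(norm \<xi>)\<^sup>2"] by (simp add: norm_mult mult.commute)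

lemma damped_fourier_integrable:
  assumes "exp_mixture f"
  shows "integrable lborel
    (\<lambda>\<xi>::'a. complex_of_real (exp (- (t * (norm \<xi>)\<^sup>2)) * f ((norm \<xi>)\<^sup>2)) * cis (2 * pi * (x \<bullet> \<xi>)))"
proof (rule Bochner_Integration.integrable_bound)
  show "integrable lborel (\<lambda>\<xi>::'a. f 0 * exp (- (t * (norm \<xi>)\<^sup>2)))"
    by (intro integrable_mult_right integrable_gaussian_euclidean t)
  show "AE \<xi> in lborel. norm (complex_of_real (exp (- (t * (norm \<xi>)\<^sup>2)) * f ((norm \<xi>)\<^sup>2)) * cis (2 * pi * (x \<bullet> \<xi>)))
          \<le> norm (f 0 * exp (- (t * (norm \<xi>)\<^sup>2)))"
    using order_trans[OF damped_fourier_norm_le[OF assms] abs_ge_self] by simp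
qed (rule damped_fourier_measurable[OF assms])

lemma damped_fourier_add:
  assumes "exp_mixture f" "exp_mixture g"
  shows "damped_fourier t (\<lambda>u. f u + g u) x = damped_fourier t f x + damped_fourier t g x"
  unfolding damped_fourier_def
  by (subst Bochner_Integration.integral_add[OF damped_fourier_integrable damped_fourier_integrable,
        OF assms, symmetric]) (simp add: algebra_simps)

lemma damped_fourier_scale: "damped_fourier t (\<lambda>u. c * f u) x = complex_of_real c * damped_fourier t f x"
  unfolding damped_fourier_def
  by (subst integral_mult_right_zero[symmetric]) (simp add: mult_ac)

lemma damped_fourier_limit:
  assumes "\<And>n. exp_mixture (F n)" "exp_mixture f" "\<And>u. 0 \<le> u \<Longrightarrow> (\<lambda>n::nat. F n u) \<longlonglongrightarrow> f u"
  shows "(\<lambda>n. damped_fourier t (F n) x) \<longlonglongrightarrow> damped_fourier t f x"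
proof -
  \<comment> \<open>Convergence at u = 0 bounds the values \<open>F n 0\<close>, and each of them
    bounds its \<open>F n\<close> on u >= 0; this gives one dominating Gaussian for all n.\<close>
  obtain B where B: "\<And>n. norm (F n 0) \<le> B"
    using convergent_imp_Bseq[of "\<lambda>n. F n 0"] assms(3)[of 0] unfolding convergent_def Bseq_def by auto
  show ?thesis
    unfolding damped_fourier_def
  proof (rule integral_dominated_convergence[where w = "\<lambda>\<xi>::'a. B * exp (- (t * (norm \<xi>)\<^sup>2))"])
    show "integrable lborel (\<lambda>\<xi>::'a. B * exp (- (t * (norm \<xi>)\<^sup>2)))"
      by (intro integrable_mult_right integrable_gaussian_euclidean t)
    show "AE \<xi> in lborel. (\<lambda>n. complex_of_real (exp (- (t * (norm \<xi>)\<^sup>2)) * F n ((norm \<xi>)\<^sup>2)) * cis (2 * pi * (x \<bullet> \<xi>)))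
        \<longlonglongrightarrow> complex_of_real (exp (- (t * (norm \<xi>)\<^sup>2)) * f ((norm \<xi>)\<^sup>2)) * cis (2 * pi * (x \<bullet> \<xi>))"
      by (intro AE_I2 tendsto_intros assms) simp
    show "AE \<xi> in lborel. norm (complex_of_real (exp (- (t * (norm \<xi>)\<^sup>2)) * F n ((norm \<xi>)\<^sup>2)) * cis (2 * pi * (x \<bullet> \<xi>)))
        \<le> B * exp (- (t * (norm \<xi>)\<^sup>2))" for n
    proof (rule AE_I2, rule order_trans[OF damped_fourier_norm_le[OF assms(1)]])
      show "F n 0 * exp (- (t * (norm \<xi>)\<^sup>2)) \<le> B * exp (- (t * (norm \<xi>)\<^sup>2))" for \<xi> :: 'a
        using B[of n] by (intro mult_right_mono) auto
    qed
  qed (use damped_fourier_measurable assms in auto)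
qed

lemma damped_fourier_exponential:
  assumes "0 \<le> l"
  shows "damped_fourier t (\<lambda>u. exp (- (l * u))) x = complex_of_real (gaussian_fourier (t + l) x)"
  unfolding damped_fourier_def
  using integral_gaussian_euclidean_cis[of "t + l" x] t assms
  by (simp add: exp_add[symmetric] algebra_simps del: exp_of_real of_real_mult)

lemma mixture_functional_Re_damped_fourier: "mixture_functional (\<lambda>f. Re (damped_fourier t f x))"
  unfolding mixture_functional_def
  by (auto simp: damped_fourier_add damped_fourier_scale intro!: tendsto_Re damped_fourier_limit)

lemma mixture_functional_Im_damped_fourier: "mixture_functional (\<lambda>f. Im (damped_fourier t f x))"
  unfolding mixture_functional_def
  by (auto simp: damped_fourier_add damped_fourier_scale intro!: tendsto_Im damped_fourier_limit)

text \<open>On exponentials the imaginary part is 0, so the transfer principle applies to it and to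
  its negative.\<close>

lemma damped_fourier_real:
  assumes "exp_mixture f"
  shows "Im (damped_fourier t f x) = 0"
proof -
  have "0 \<le> Im (damped_fourier t f x)"
    by (rule mixture_functional_nonneg[OF mixture_functional_Im_damped_fourier _ assms])
       (simp add: damped_fourier_exponential)
  moreover have "0 \<le> - 1 * Im (damped_fourier t f x)"
    by (rule mixture_functional_nonneg[OF mixture_functional_scale[OF mixture_functional_Im_damped_fourier] _ assms])
       (simp add: damped_fourier_exponential)
  ultimately show ?thesis by simp
qed

lemma damped_fourier_nonneg:
  assumes "exp_mixture f"
  shows "0 \<le> Re (damped_fourier t f x)"
  by (rule mixture_functional_nonneg[OF mixture_functional_Re_damped_fourier _ assms])
     (use t in \<open>simp add: damped_fourier_exponential gaussian_fourier_def\<close>)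

end

lemma damped_fourier_antimono:
  fixes x y :: "'a::euclidean_space"
  assumes "0 < t" "norm x \<le> norm y" "exp_mixture f"
  shows "Re (damped_fourier t f y) \<le> Re (damped_fourier t f x)"
proof -
  have "0 \<le> Re (damped_fourier t f x) - Re (damped_fourier t f y)"
  proof (rule mixture_functional_nonneg[OF _ _ assms(3)])
    show "mixture_functional (\<lambda>f. Re (damped_fourier t f x) - Re (damped_fourier t f y))"
      by (intro mixture_functional_diff mixture_functional_Re_damped_fourier assms)
    fix l :: real assume "0 \<le> l"
    then have "gaussian_fourier (t + l) y \<le> gaussian_fourier (t + l) x"
      unfolding gaussian_fourier_def using assms
      by (intro mult_left_mono) (auto intro!: divide_right_mono mult_left_mono power_mono)
    then show "0 \<le> Re (damped_fourier t (\<lambda>u. exp (- (l * u))) x) - Re (damped_fourier t (\<lambda>u. exp (- (l * u))) y)"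
      using \<open>0 \<le> l\<close> assms by (simp add: damped_fourier_exponential)
  qed
  then show ?thesis by simp
qed

lemma heat_kernel_eq_damped_fourier:
  fixes x :: "real ^ 'n"
  shows "heat_kernel s x t = damped_fourier t (\<lambda>u. exp (- (t * u powr s))) x"
proof -
  have "((norm \<xi>)\<^sup>2) powr s = norm \<xi> powr (2 * s)" for \<xi> :: "real ^ 'n"
    by (cases "norm \<xi> = 0") (simp_all add: powr_powr flip: powr_numeral)
  then show ?thesis
    unfolding heat_kernel_def damped_fourier_def
    by (intro Bochner_Integration.integral_cong refl)
       (simp add: cis_conv_exp exp_add[symmetric] exp_of_real[symmetric] algebra_simps)
qed

lemma exp_mixture_stable: "0 < s \<Longrightarrow> s < 1 \<Longrightarrow> 0 \<le> t \<Longrightarrow> exp_mixture (\<lambda>u. exp (- (t * u powr s)))"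
  using laplace_exponent_powr unfolding laplace_exponent_def by blast

section \<open>Estimates valid for every mixture\<close>

lemma sqrt_divide_power:
  assumes "0 < t"
  shows "sqrt (c / t) ^ n = sqrt c ^ n * t powr (- real n / 2)"
proof -
  have "sqrt t ^ n = t powr (real n / 2)"
    using assms by (simp add: powr_half_sqrt[symmetric] powr_realpow[symmetric] powr_powr)
  then show ?thesis
    using assms by (simp add: real_sqrt_divide power_divide powr_minus field_simps)
qed

text \<open>Absorbs the polynomial prefactor of the Gaussian with an explicit constant; the proof
  applies 1 + v <= exp v at v = w / m.\<close>

lemma one_plus_power_le_exp:
  fixes w :: real
  assumes "0 \<le> w" "0 < m"
  shows "(1 + w) ^ m \<le> real m ^ m * exp w"
proof -
  have "1 + w \<le> real m * (1 + w / real m)"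
    using assms by (simp add: distrib_left)
  also have "\<dots> \<le> real m * exp (w / real m)"
    by (intro mult_left_mono exp_ge_add_one_self) simp
  finally have "(1 + w) ^ m \<le> (real m * exp (w / real m)) ^ m"
    using assms by (intro power_mono) auto
  also have "\<dots> = real m ^ m * exp w"
    using assms by (simp add: power_mult_distrib exp_of_nat_mult[symmetric])
  finally show ?thesis .
qed

text \<open>Rests on (1 + v) (1 - v + v^2) = 1 + v^3 >= 1.\<close>

lemma exp_minus_le_quadratic:
  fixes v :: real
  assumes "0 \<le> v"
  shows "exp (- v) \<le> 1 - v + v\<^sup>2"
proof -
  have "exp (- v) = inverse (exp v)" by (rule exp_minus)
  also have "\<dots> \<le> inverse (1 + v)"
    using assms by (intro le_imp_inverse_le) auto
  also have "\<dots> \<le> 1 - v + v\<^sup>2"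
    using assms by (simp add: field_simps power2_eq_square)
  finally show ?thesis .
qed

text \<open>The Gaussian bound does not depend on l, and the constant 1 is exp (- l 0); this is why
  \<open>f\<close> is evaluated at 0.\<close>

lemma damped_fourier_le_diagonal:
  fixes x :: "'a::euclidean_space"
  assumes t: "0 < t" and f: "exp_mixture f"
  shows "Re (damped_fourier t f x) \<le> sqrt (pi / t) ^ DIM('a) * f 0"
proof -
  have "0 \<le> sqrt (pi / t) ^ DIM('a) * f 0 - Re (damped_fourier t f x)"
  proof (rule mixture_functional_nonneg[OF _ _ f])
    show "mixture_functional (\<lambda>f. sqrt (pi / t) ^ DIM('a) * f 0 - Re (damped_fourier t f x))"
      by (intro mixture_functional_diff mixture_functional_scale mixture_functional_eval
            mixture_functional_Re_damped_fourier t) simp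
    fix l :: real assume l: "0 \<le> l"
    have "gaussian_fourier (t + l) x \<le> sqrt (pi / t) ^ DIM('a) * 1"
      unfolding gaussian_fourier_def using t l
      by (intro mult_mono power_mono) (auto intro!: divide_left_mono)
    then show "0 \<le> sqrt (pi / t) ^ DIM('a) * exp (- (l * 0)) - Re (damped_fourier t (\<lambda>u. exp (- (l * u))) x)"
      by (simp add: damped_fourier_exponential[OF t l])
  qed
  then show ?thesis by simp
qed

text \<open>In terms of z = |x|^2 / \<tau> the left side is (pi z)^(n/2) exp (- pi^2 z), which is at
  most a constant times 1 / (1 + z) <= 1 - exp (- 1 / z). This last form is chosen because at \<tau>
  = t + l it is a combination of exponentials in l, with u = 0 and u = 1 / |x|^2.\<close>

lemma gaussian_fourier_le_tail:
  fixes x :: "'a::euclidean_space"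
  assumes "0 < \<tau>" "x \<noteq> 0"
  shows "norm x ^ DIM('a) * gaussian_fourier \<tau> x
           \<le> real (Suc DIM('a)) ^ Suc DIM('a) * (1 - exp (- (\<tau> / (norm x)\<^sup>2)))"
proof -
  let ?n = "DIM('a)" and ?m = "Suc DIM('a)"
  define z where "z = (norm x)\<^sup>2 / \<tau>"
  have z: "0 < z" using assms by (simp add: z_def)
  have "norm x * sqrt (pi / \<tau>) = sqrt (pi * z)"
    using assms by (simp add: z_def real_sqrt_mult real_sqrt_divide)
  then have "norm x ^ ?n * gaussian_fourier \<tau> x = sqrt (pi * z) ^ ?n * exp (- (pi\<^sup>2 * z))"
    by (simp add: gaussian_fourier_def z_def mult.assoc[symmetric] power_mult_distrib[symmetric])
  also have "\<dots> \<le> real ?m ^ ?m * (1 / (1 + z))"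
  proof -
    have p: "1 \<le> pi" using pi_ge_two by simp
    have "sqrt (pi * z) \<le> sqrt ((1 + pi * z)\<^sup>2)"
      using z by (intro real_sqrt_le_mono) (simp add: power2_eq_square algebra_simps)
    then have 1: "sqrt (pi * z) \<le> 1 + pi * z" using z by simp
    have 2: "1 + z \<le> 1 + pi * z" using p z by simp
    \<comment> \<open>The extra factor 1 + z raises the power from n to n + 1, whence the
      constant.\<close>
    have "sqrt (pi * z) ^ ?n * (1 + z) \<le> (1 + pi * z) ^ ?n * (1 + pi * z)"
      using z by (intro mult_mono power_mono 1 2) auto
    also have "\<dots> = (1 + pi * z) ^ ?m" by simp
    also have "\<dots> \<le> real ?m ^ ?m * exp (pi * z)"
      using z by (intro one_plus_power_le_exp) auto
    also have "\<dots> \<le> real ?m ^ ?m * exp (pi\<^sup>2 * z)"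
      using p z by (intro mult_left_mono) (auto simp: power2_eq_square)
    finally show ?thesis
      using z by (simp add: exp_minus field_simps del: power_Suc of_nat_Suc)
  qed
  also have "1 / (1 + z) \<le> 1 - exp (- (1 / z))"
  proof -
    have "exp (- (1 / z)) \<le> inverse (1 + 1 / z)"
      unfolding exp_minus using z by (intro le_imp_inverse_le) (auto simp: add_pos_pos)
    then show ?thesis using z by (simp add: field_simps)
  qed
  finally show ?thesis
    by (simp add: z_def mult_left_mono del: power_Suc of_nat_Suc)
qed

lemma damped_fourier_le_tail:
  fixes x :: "'a::euclidean_space"
  assumes t: "0 < t" and x: "x \<noteq> 0" and f: "exp_mixture f"
  shows "norm x ^ DIM('a) * Re (damped_fourier t f x)
           \<le> real (Suc DIM('a)) ^ Suc DIM('a) * (f 0 - exp (- (t / (norm x)\<^sup>2)) * f (1 / (norm x)\<^sup>2))"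
proof -
  let ?C = "real (Suc DIM('a)) ^ Suc DIM('a)"
  let ?\<Psi> = "\<lambda>f. ?C * (f 0 - exp (- (t / (norm x)\<^sup>2)) * f (1 / (norm x)\<^sup>2))
                - norm x ^ DIM('a) * Re (damped_fourier t f x)"
  have "0 \<le> ?\<Psi> f"
  proof (rule mixture_functional_nonneg[OF _ _ f])
    show "mixture_functional ?\<Psi>"
      by (intro mixture_functional_diff mixture_functional_scale mixture_functional_eval
            mixture_functional_Re_damped_fourier t) simp_all
    fix l :: real assume l: "0 \<le> l"
    have "exp (- (t / (norm x)\<^sup>2)) * exp (- (l * (1 / (norm x)\<^sup>2))) = exp (- ((t + l) / (norm x)\<^sup>2))"
      by (simp add: exp_add[symmetric] add_divide_distrib)
    then show "0 \<le> ?\<Psi> (\<lambda>u. exp (- (l * u)))"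
      using gaussian_fourier_le_tail[of "t + l" x] t l x
      by (simp add: damped_fourier_exponential[OF t l] del: power_Suc of_nat_Suc)
  qed
  then show ?thesis by simp
qed

text \<open>From 1 + l / t <= exp (l / t), the prefactor of G(x, t + l) loses at most exp (- l n /
  (2 t)) against that of G(x, t), which fixes the evaluation point n / (2 t). Since |x|^2 <= t + l,
  the Gaussian factor is at least exp (- pi^2).\<close>

lemma damped_fourier_ge_diagonal:
  fixes x :: "'a::euclidean_space"
  assumes t: "0 < t" and x: "(norm x)\<^sup>2 \<le> t" and f: "exp_mixture f"
  shows "exp (- pi\<^sup>2) * sqrt (pi / t) ^ DIM('a) * f (real DIM('a) / (2 * t)) \<le> Re (damped_fourier t f x)"
proof -
  let ?n = "DIM('a)"
  let ?\<Psi> = "\<lambda>f. Re (damped_fourier t f x) - exp (- pi\<^sup>2) * sqrt (pi / t) ^ ?n * f (real ?n / (2 * t))"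
  have "0 \<le> ?\<Psi> f"
  proof (rule mixture_functional_nonneg[OF _ _ f])
    show "mixture_functional ?\<Psi>"
      using t by (intro mixture_functional_diff mixture_functional_scale mixture_functional_eval
            mixture_functional_Re_damped_fourier t) simp_all
    fix l :: real assume l: "0 \<le> l"
    have "sqrt (pi / t) * exp (- (l / (2 * t))) \<le> sqrt (pi / (t + l))"
    proof (rule real_le_rsqrt)
      have "t + l \<le> t * exp (l / t)"
        using exp_ge_add_one_self[of "l / t"] t by (simp add: field_simps)
      then have "pi / (t * exp (l / t)) \<le> pi / (t + l)"
        using t l by (intro divide_left_mono) auto
      moreover have "exp (- (l / (2 * t))) ^ 2 = exp (- (l / t))"
        by (simp add: exp_of_nat_mult[symmetric] power2_eq_square exp_add[symmetric])
      ultimately show "(sqrt (pi / t) * exp (- (l / (2 * t))))\<^sup>2 \<le> pi / (t + l)"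
        using t by (simp add: power_mult_distrib exp_minus field_simps)
    qed
    then have "(sqrt (pi / t) * exp (- (l / (2 * t)))) ^ ?n \<le> sqrt (pi / (t + l)) ^ ?n"
      using t by (intro power_mono) auto
    moreover have "exp (- (l / (2 * t))) ^ ?n = exp (- (l * (real ?n / (2 * t))))"
      by (simp add: exp_of_nat_mult[symmetric] mult.commute)
    ultimately have 1: "sqrt (pi / t) ^ ?n * exp (- (l * (real ?n / (2 * t)))) \<le> sqrt (pi / (t + l)) ^ ?n"
      by (simp add: power_mult_distrib)
    have "pi\<^sup>2 * (norm x)\<^sup>2 \<le> pi\<^sup>2 * (t + l)"
      using x l by (intro mult_left_mono) auto
    then have 2: "exp (- pi\<^sup>2) \<le> exp (- (pi\<^sup>2 * (norm x)\<^sup>2 / (t + l)))"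
      using t l by (simp add: pos_divide_le_eq)
    have "(sqrt (pi / t) ^ ?n * exp (- (l * (real ?n / (2 * t))))) * exp (- pi\<^sup>2) \<le> gaussian_fourier (t + l) x"
      unfolding gaussian_fourier_def using t l by (intro mult_mono 1 2) auto
    then show "0 \<le> ?\<Psi> (\<lambda>u. exp (- (l * u)))"
      unfolding damped_fourier_exponential[OF t l] by (simp add: mult_ac)
  qed
  then show ?thesis by simp
qed

text \<open>
  With \<open>y = exp (- l / (K |x|\<^sup>2))\<close>, the combination of the values of \<open>f\<close> below becomes
  \<open>y (1 - y)\<^sup>2 - \<delta> y (1 - y)\<close>, which is negative unless \<open>l\<close> is at least of order \<open>|x|\<^sup>2\<close>;
  this is where the Gaussian transform is not small.
\<close>

lemma damped_fourier_ge_tail: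
  fixes x :: "'a::euclidean_space" and K \<delta> :: real
  defines "c \<equiv> sqrt (1 / (1 + K * real DIM('a) / 2)) ^ DIM('a) * exp (- (pi\<^sup>2 / (K * \<delta>)))"
  assumes t: "0 < t" "t \<le> (norm x)\<^sup>2" and K: "0 < K" and \<delta>: "0 < \<delta>" and f: "exp_mixture f"
  defines "a \<equiv> 1 / (K * (norm x)\<^sup>2)"
  shows "c * ((f a - 2 * f (2 * a) + f (3 * a)) - \<delta> * (f a - f (2 * a)))
           \<le> norm x ^ DIM('a) * Re (damped_fourier t f x)"
proof -
  let ?n = "DIM('a)"
  have x: "0 < norm x" using t by (cases "x = 0") auto
  have a: "0 < a" using K x by (simp add: a_def)
  have c: "0 < c" using K by (auto simp: c_def intro!: mult_pos_pos zero_less_power add_pos_nonneg)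
  let ?\<Psi> = "\<lambda>f. norm x ^ ?n * Re (damped_fourier t f x)
    - c * ((f a - 2 * f (2 * a) + f (3 * a)) - \<delta> * (f a - f (2 * a)))"
  have "0 \<le> ?\<Psi> f"
  proof (rule mixture_functional_nonneg[OF _ _ f])
    show "mixture_functional ?\<Psi>"
      using a by (intro mixture_functional_diff mixture_functional_add mixture_functional_scale
            mixture_functional_eval mixture_functional_Re_damped_fourier t) simp_all
    fix l :: real assume l: "0 \<le> l"
    define \<rho> where "\<rho> = l * a"
    define y where "y = exp (- \<rho>)"
    have \<rho>: "0 \<le> \<rho>" using l a by (simp add: \<rho>_def)
    have y: "0 < y" "y \<le> 1" "1 - y \<le> \<rho>"
      using \<rho> exp_ge_add_one_self[of "- \<rho>"] by (auto simp: y_def)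
    have pow: "exp (- (l * a)) = y" "exp (- (l * (2 * a))) = y\<^sup>2" "exp (- (l * (3 * a))) = y ^ 3"
      by (simp_all add: y_def \<rho>_def exp_of_nat_mult[symmetric] mult_ac)
    have h: "(y - 2 * y\<^sup>2 + y ^ 3) - \<delta> * (y - y\<^sup>2) = y * (1 - y) * ((1 - y) - \<delta>)"
      by (simp add: power2_eq_square power3_eq_cube algebra_simps)
    have G: "0 \<le> gaussian_fourier (t + l) x"
      using t l by (simp add: gaussian_fourier_def)
    \<comment> \<open>If \<rho> <= \<delta>, then 1 - y <= \<delta> and the left side is
      nonpositive. Otherwise l > K \<delta> |x|^2, which bounds the Gaussian factor below by the
      second factor of \<open>c\<close>.\<close>
    have "c * (y * (1 - y) * ((1 - y) - \<delta>)) \<le> norm x ^ ?n * gaussian_fourier (t + l) x"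
    proof (cases "\<rho> \<le> \<delta>")
      case True
      then have "y * (1 - y) * ((1 - y) - \<delta>) \<le> 0"
        using y by (intro mult_nonneg_nonpos) auto
      then have "c * (y * (1 - y) * ((1 - y) - \<delta>)) \<le> 0"
        using c by (simp add: mult_nonneg_nonpos)
      also have "0 \<le> norm x ^ ?n * gaussian_fourier (t + l) x"
        using G by simp
      finally show ?thesis .
    next
      case False
      have "(1 - y) * ((1 - y) - \<delta>) \<le> 1 * 1"
      proof (cases "1 - y \<le> \<delta>")
        case True
        then have "(1 - y) * ((1 - y) - \<delta>) \<le> 0"
          using y by (intro mult_nonneg_nonpos) auto
        then show ?thesis by simp
      qed (use y \<delta> in \<open>intro mult_mono; simp\<close>)
      then have "y * ((1 - y) * ((1 - y) - \<delta>)) \<le> y * (1 * 1)"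
        using y by (intro mult_left_mono) auto
      then have 1: "y * (1 - y) * ((1 - y) - \<delta>) \<le> y" by (simp add: mult.assoc)
      have l': "l = K * \<rho> * (norm x)\<^sup>2"
        using K x by (simp add: \<rho>_def a_def)
      have lpos: "0 < l" using False \<delta> K x unfolding l' by simp
      have "t + l \<le> (norm x)\<^sup>2 * (1 + K * \<rho>)"
        using t by (simp add: l' algebra_simps)
      \<comment> \<open>The rate 2 \<rho> / n is chosen so that, after the square root and the n-th
        power, the loss in the prefactor is exactly exp (- \<rho>) = y, the factor kept on the left
        side.\<close>
      also have "1 + K * \<rho> \<le> (1 + K * real ?n / 2) * exp (2 * \<rho> / real ?n)"
      proof -
        have n: "0 < real ?n" by simp
        have "2 * \<rho> / real ?n \<le> exp (2 * \<rho> / real ?n)"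
          using exp_ge_add_one_self[of "2 * \<rho> / real ?n"] by linarith
        then have "(K * real ?n / 2) * (2 * \<rho> / real ?n) \<le> (K * real ?n / 2) * exp (2 * \<rho> / real ?n)"
          using K by (intro mult_left_mono) auto
        moreover have "(K * real ?n / 2) * (2 * \<rho> / real ?n) = K * \<rho>"
          using n by simp
        moreover have "1 \<le> exp (2 * \<rho> / real ?n)" using \<rho> by simp
        ultimately show ?thesis unfolding distrib_right by linarith
      qed
      finally have tl: "t + l \<le> (norm x)\<^sup>2 * ((1 + K * real ?n / 2) * exp (2 * \<rho> / real ?n))"
        by (simp add: mult_left_mono)
      have M: "0 < 1 + K * real ?n / 2" using K by (simp add: add_pos_nonneg)
      have "sqrt (1 / (1 + K * real ?n / 2)) * exp (- (\<rho> / real ?n)) \<le> norm x * sqrt (pi / (t + l))"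
      proof -
        have cancel: "r * (1 / (r * (v * w))) = 1 / v * inverse w" if "r \<noteq> 0" for r v w :: real
          using that by (simp add: inverse_eq_divide)
        have "(1 / (1 + K * real ?n / 2)) * exp (- (2 * \<rho> / real ?n))
            = (norm x)\<^sup>2 * (1 / ((norm x)\<^sup>2 * ((1 + K * real ?n / 2) * exp (2 * \<rho> / real ?n))))"
          unfolding exp_minus using x by (intro cancel[symmetric]) simp
        also have "\<dots> \<le> (norm x)\<^sup>2 * (pi / (t + l))"
          using tl t l M x pi_ge_two by (intro mult_left_mono frac_le) auto
        finally have "sqrt ((1 / (1 + K * real ?n / 2)) * exp (- (2 * \<rho> / real ?n)))
            \<le> sqrt ((norm x)\<^sup>2 * (pi / (t + l)))"
          by (rule real_sqrt_le_mono)
        moreover have "sqrt (exp (- (2 * \<rho> / real ?n))) = exp (- (\<rho> / real ?n))"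
          by (rule real_sqrt_unique) (simp_all add: power2_eq_square exp_add[symmetric])
        ultimately show ?thesis
          using x by (simp only: real_sqrt_mult real_sqrt_abs abs_norm_cancel)
      qed
      then have "(sqrt (1 / (1 + K * real ?n / 2)) * exp (- (\<rho> / real ?n))) ^ ?n \<le> (norm x * sqrt (pi / (t + l))) ^ ?n"
        using M by (intro power_mono) auto
      moreover have "exp (- (\<rho> / real ?n)) ^ ?n = y"
        by (simp add: y_def exp_of_nat_mult[symmetric])
      ultimately have 2: "sqrt (1 / (1 + K * real ?n / 2)) ^ ?n * y \<le> norm x ^ ?n * sqrt (pi / (t + l)) ^ ?n"
        by (simp only: power_mult_distrib)
      have "(norm x)\<^sup>2 / (t + l) \<le> 1 / (K * \<delta>)"
      proof -
        have "K * \<delta> * (norm x)\<^sup>2 \<le> K * \<rho> * (norm x)\<^sup>2"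
          using False K by (intro mult_right_mono mult_left_mono) auto
        then show ?thesis
          using t K \<delta> lpos unfolding l'[symmetric] by (simp add: field_simps)
      qed
      then have "pi\<^sup>2 * ((norm x)\<^sup>2 / (t + l)) \<le> pi\<^sup>2 * (1 / (K * \<delta>))"
        by (intro mult_left_mono) auto
      then have 3: "exp (- (pi\<^sup>2 / (K * \<delta>))) \<le> exp (- (pi\<^sup>2 * (norm x)\<^sup>2 / (t + l)))"
        by simp
      have "c * (y * (1 - y) * ((1 - y) - \<delta>)) \<le> c * y"
        using c 1 by (intro mult_left_mono) auto
      also have "\<dots> = (sqrt (1 / (1 + K * real ?n / 2)) ^ ?n * y) * exp (- (pi\<^sup>2 / (K * \<delta>)))"
        by (simp add: c_def)
      also have "\<dots> \<le> (norm x ^ ?n * sqrt (pi / (t + l)) ^ ?n) * exp (- (pi\<^sup>2 * (norm x)\<^sup>2 / (t + l)))"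
        using t l by (intro mult_mono 2 3) auto
      finally show ?thesis by (simp add: gaussian_fourier_def)
    qed
    then show "0 \<le> ?\<Psi> (\<lambda>u. exp (- (l * u)))"
      by (simp only: damped_fourier_exponential[OF t(1) l] pow h Re_complex_of_real diff_ge_0_iff_ge)
  qed
  then show ?thesis by simp
qed

section \<open>Concavity of \<open>u powr s\<close> and the integral of exp (- t |xi|^(2s))\<close>

text \<open>The slope over (2, 3) is smaller than over (1, 2). For small t this makes the second
  difference of exp (- t u^s) at a, 2a, 3a positive to first order in t.\<close>

lemma powr_concave_strict:
  assumes "0 < s" "s < 1"
  shows "1 + 3 powr s < 2 * (2 powr s :: real)"
proof -
  have d: "((\<lambda>u. u powr s) has_real_derivative s * u powr (s - 1)) (at u)" if "0 < u" for u :: real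
    using that by (auto intro!: derivative_eq_intros)
  obtain v where v: "1 < v" "v < 2" "2 powr s - 1 powr s = (2 - 1) * (s * v powr (s - 1))"
    using MVT2[of 1 2 "\<lambda>u. u powr s" "\<lambda>u. s * u powr (s - 1)"] d by auto
  obtain w where w: "2 < w" "w < 3" "3 powr s - 2 powr s = (3 - 2) * (s * w powr (s - 1))"
    using MVT2[of 2 3 "\<lambda>u. u powr s" "\<lambda>u. s * u powr (s - 1)"] d by auto
  have "w powr (s - 1) < v powr (s - 1)"
    using v w assms by (intro powr_less_mono2_neg) auto
  then have "s * w powr (s - 1) < s * v powr (s - 1)"
    using assms by simp
  then show ?thesis
    using v(3) w(3) by simp
qed

text \<open>The shell k <= t |xi|^(2s) < k + 1 lies in the ball of radius ((k + 1) / t)^(1 / (2s)),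
  on which exp (- k) is used. The power of t factors out of the ball volumes and a convergent series
  remains.\<close>

lemma nn_integral_exp_powr_le:
  assumes "0 < s"
  obtains D where "0 < D"
    "\<And>t. 0 < t \<Longrightarrow> (\<integral>\<^sup>+\<xi>. ennreal (exp (- (t * norm (\<xi>::'a::euclidean_space) powr (2 * s)))) \<partial>lborel)
         \<le> ennreal (D * t powr (- real DIM('a) / (2 * s)))"
proof -
  define p where "p = real DIM('a) / (2 * s)"
  have p: "0 < p" using assms by (simp add: p_def)
  define A where "A = (\<lambda>k::nat. exp (- real k) * (real (Suc k)) powr p)"
  have A0: "0 \<le> A k" for k by (simp add: A_def)
  have "summable A"
  proof (rule summable_comparison_test')
    show "summable (\<lambda>k. (2 * p) powr p * exp (1 / 2) * exp (- (1 / 2)) ^ k)"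
      by (intro summable_mult summable_geometric) simp
    fix k :: nat
    \<comment> \<open>The power (k + 1)^p is traded for exp ((k + 1) / 2), so half of the decay exp
      (- k) is left for the geometric series.\<close>
    have "real (Suc k) / (2 * p) \<le> exp (real (Suc k) / (2 * p))"
      using exp_ge_add_one_self[of "real (Suc k) / (2 * p)"] by linarith
    then have "real (Suc k) \<le> (2 * p) * exp (real (Suc k) / (2 * p))"
      using p by (simp add: field_simps)
    then have "real (Suc k) powr p \<le> ((2 * p) * exp (real (Suc k) / (2 * p))) powr p"
      using p by (intro powr_mono2) auto
    also have "\<dots> = (2 * p) powr p * exp (real (Suc k) / 2)"
      using p by (subst powr_mult) (simp_all add: exp_powr_real del: of_nat_Suc)
    finally have "A k \<le> exp (- real k) * ((2 * p) powr p * exp (real (Suc k) / 2))"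
      unfolding A_def by (intro mult_left_mono) auto
    also have "\<dots> = (2 * p) powr p * exp (1 / 2) * exp (- (1 / 2)) ^ k"
      by (simp add: exp_of_nat_mult[symmetric] exp_add[symmetric] add_divide_distrib) 
    finally show "norm (A k) \<le> (2 * p) powr p * exp (1 / 2) * exp (- (1 / 2)) ^ k"
      using A0 by simp
  qed
  define D where "D = unit_ball_vol (real DIM('a)) * suminf A"
  have "0 < suminf A"
    by (rule suminf_pos[OF \<open>summable A\<close>]) (simp add: A_def)
  then have "0 < D" by (simp add: D_def)
  moreover have "(\<integral>\<^sup>+\<xi>. ennreal (exp (- (t * norm (\<xi>::'a) powr (2 * s)))) \<partial>lborel)
         \<le> ennreal (D * t powr (- real DIM('a) / (2 * s)))" if t: "0 < t" for t
  proof -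
    define r where "r = (\<lambda>k::nat. (real (Suc k) / t) powr (1 / (2 * s)))"
    have r: "unit_ball_vol (real DIM('a)) * r k ^ DIM('a) * exp (- real k)
        = unit_ball_vol (real DIM('a)) * t powr (- p) * A k" for k
    proof -
      have "r k ^ DIM('a) = (real (Suc k) / t) powr p"
        using t by (simp add: r_def p_def powr_realpow[symmetric] powr_powr)
      then show ?thesis
        using t by (simp add: A_def powr_divide powr_minus field_simps)
    qed
    have [measurable]: "ball (0::'a) (r k) \<in> sets borel" for k by simp
    have "(\<integral>\<^sup>+\<xi>. ennreal (exp (- (t * norm (\<xi>::'a) powr (2 * s)))) \<partial>lborel)
        \<le> (\<integral>\<^sup>+\<xi>. (\<Sum>k. ennreal (exp (- real k)) * indicator (ball (0::'a) (r k)) \<xi>) \<partial>lborel)"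
    proof (rule nn_integral_mono)
      fix \<xi> :: 'a
      define v where "v = t * norm \<xi> powr (2 * s)"
      define k where "k = nat \<lfloor>v\<rfloor>"
      have "0 \<le> v" using t by (simp add: v_def)
      then have k: "real k \<le> v" "v < real (Suc k)"
        unfolding k_def by linarith+
      have "norm \<xi> powr (2 * s) < real (Suc k) / t"
        using k t by (simp add: v_def field_simps)
      then have "(norm \<xi> powr (2 * s)) powr (1 / (2 * s)) < r k"
        unfolding r_def using assms by (intro powr_less_mono2) auto
      then have "\<xi> \<in> ball 0 (r k)"
        using assms by (simp add: powr_powr)
      then have "ennreal (exp (- v)) \<le> ennreal (exp (- real k)) * indicator (ball (0::'a) (r k)) \<xi>"
        using k by (simp add: ennreal_leI)
      also have "\<dots> \<le> (\<Sum>k. ennreal (exp (- real k)) * indicator (ball (0::'a) (r k)) \<xi>)"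
        using sum_le_suminf[OF summableI, of "{k}" "\<lambda>k. ennreal (exp (- real k)) * indicator (ball (0::'a) (r k)) \<xi>"]
        by (simp only: sum.insert sum.empty finite.intros empty_iff not_False_eq_True add_0_right) simp
      finally show "ennreal (exp (- (t * norm \<xi> powr (2 * s))))
          \<le> (\<Sum>k. ennreal (exp (- real k)) * indicator (ball (0::'a) (r k)) \<xi>)"
        by (simp add: v_def)
    qed
    also have "\<dots> = (\<Sum>k. \<integral>\<^sup>+\<xi>. ennreal (exp (- real k)) * indicator (ball (0::'a) (r k)) \<xi> \<partial>lborel)"
      by (rule nn_integral_suminf) measurable
    also have "\<dots> = (\<Sum>k. ennreal (unit_ball_vol (real DIM('a)) * t powr (- p) * A k))"
    proof (rule suminf_cong)
      fix k
      have "(\<integral>\<^sup>+\<xi>. ennreal (exp (- real k)) * indicator (ball (0::'a) (r k)) \<xi> \<partial>lborel)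
          = ennreal (exp (- real k)) * emeasure lborel (ball (0::'a) (r k))"
        by (rule nn_integral_cmult_indicator) simp
      also have "\<dots> = ennreal (exp (- real k)) * ennreal (unit_ball_vol (real DIM('a)) * r k ^ DIM('a))"
        by (subst emeasure_ball) (simp_all add: r_def)
      also have "\<dots> = ennreal (unit_ball_vol (real DIM('a)) * r k ^ DIM('a) * exp (- real k))"
        by (subst ennreal_mult[symmetric]) (simp_all add: r_def mult.commute)
      finally show "(\<integral>\<^sup>+\<xi>. ennreal (exp (- real k)) * indicator (ball (0::'a) (r k)) \<xi> \<partial>lborel)
          = ennreal (unit_ball_vol (real DIM('a)) * t powr (- p) * A k)"
        by (simp only: r)
    qed
    also have "\<dots> = ennreal (\<Sum>k. unit_ball_vol (real DIM('a)) * t powr (- p) * A k)"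
      using \<open>summable A\<close> A0 by (intro suminf_ennreal2) auto
    also have "(\<Sum>k. unit_ball_vol (real DIM('a)) * t powr (- p) * A k) = D * t powr (- p)"
      by (subst suminf_mult[OF \<open>summable A\<close>]) (simp add: D_def)
    finally show ?thesis by (simp add: p_def)
  qed
  ultimately show thesis by (rule that)
qed

section \<open>Bounds for the kernel itself\<close>

text \<open>The Gaussian damping at the same time t is included, so this is the real part of the
  full mixed kernel, over any Euclidean space.\<close>

definition stable_kernel :: "real \<Rightarrow> real \<Rightarrow> 'a::euclidean_space \<Rightarrow> real" where
  "stable_kernel s t x = Re (damped_fourier t (\<lambda>u. exp (- (t * u powr s))) x)"

context
  fixes s :: real
  assumes s: "0 < s" "s < 1"
begin

lemma stable_kernel_le_gauss_diagonal:
  fixes x :: "'a::euclidean_space"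
  assumes t: "0 < t"
  shows "stable_kernel s t x \<le> sqrt pi ^ DIM('a) * t powr (- real DIM('a) / 2)"
  using damped_fourier_le_diagonal[OF t exp_mixture_stable[OF s, of t], of x] t
  by (simp add: stable_kernel_def sqrt_divide_power)

lemma stable_kernel_le_stable_diagonal:
  obtains D where "0 < D"
    "\<And>t x. 0 < t \<Longrightarrow> stable_kernel s t (x::'a::euclidean_space) \<le> D * t powr (- real DIM('a) / (2 * s))"
proof -
  obtain D where D: "0 < D"
    "\<And>t. 0 < t \<Longrightarrow> (\<integral>\<^sup>+\<xi>. ennreal (exp (- (t * norm (\<xi>::'a) powr (2 * s)))) \<partial>lborel)
         \<le> ennreal (D * t powr (- real DIM('a) / (2 * s)))"
    using nn_integral_exp_powr_le[OF s(1)] by blast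
  have "stable_kernel s t x \<le> D * t powr (- real DIM('a) / (2 * s))" if t: "0 < t" for t and x :: 'a
  proof -
    let ?f = "\<lambda>u. exp (- (t * u powr s))"
    have "ennreal (stable_kernel s t x) \<le> ennreal (norm (damped_fourier t ?f x))"
      unfolding stable_kernel_def by (intro ennreal_leI complex_Re_le_cmod)
    also have "\<dots> \<le> (\<integral>\<^sup>+\<xi>. ennreal (norm (complex_of_real (exp (- (t * (norm \<xi>)\<^sup>2)) * ?f ((norm \<xi>)\<^sup>2))
                        * cis (2 * pi * (x \<bullet> \<xi>)))) \<partial>lborel)"
      unfolding damped_fourier_def
      by (rule integral_norm_bound_ennreal[OF damped_fourier_integrable[OF t exp_mixture_stable[OF s]]])
         (use t in simp)
    also have "\<dots> \<le> (\<integral>\<^sup>+\<xi>. ennreal (exp (- (t * norm (\<xi>::'a) powr (2 * s)))) \<partial>lborel)"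
    proof (intro nn_integral_mono ennreal_leI)
      fix \<xi> :: 'a
      have "((norm \<xi>)\<^sup>2) powr s = norm \<xi> powr (2 * s)"
        by (cases "norm \<xi> = 0") (simp_all add: powr_powr flip: powr_numeral)
      then show "norm (complex_of_real (exp (- (t * (norm \<xi>)\<^sup>2)) * ?f ((norm \<xi>)\<^sup>2)) * cis (2 * pi * (x \<bullet> \<xi>)))
          \<le> exp (- (t * norm \<xi> powr (2 * s)))"
        using t by (simp add: norm_mult)
    qed
    also have "\<dots> \<le> ennreal (D * t powr (- real DIM('a) / (2 * s)))"
      by (rule D(2)[OF t])
    finally show ?thesis
      using D(1) by (simp add: ennreal_le_iff)
  qed
  with D(1) show thesis by (rule that)
qed

text \<open>For |x|^2 <= t the diagonal bound t^(-n/2) is already below a multiple of t^s /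
  |x|^(n+2s). For |x|^2 > t, 1 - exp (- v) <= v yields t / |x|^2 + t / |x|^(2s), and t / |x|^2 < 1
  lets the first term be raised to the power s. \<open>C\<close> adds up the constants of the two
  cases.\<close>

lemma stable_kernel_le_tail:
  fixes x :: "'a::euclidean_space"
  assumes t: "0 < t" and x: "x \<noteq> 0"
  defines "C \<equiv> sqrt pi ^ DIM('a) + 2 * real (Suc DIM('a)) ^ Suc DIM('a)"
  shows "stable_kernel s t x \<le> C * (max t (t powr s) / norm x powr (real DIM('a) + 2 * s))"
proof -
  let ?n = "DIM('a)"
  let ?d = "norm x powr (real ?n + 2 * s)"
  let ?m = "max t (t powr s) / ?d"
  have R: "0 < norm x" using x by simp
  have d: "?d = norm x ^ ?n * norm x powr (2 * s)" "0 < ?d"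
    using R by (simp_all add: powr_add powr_realpow)
  have sq: "((norm x)\<^sup>2) powr v = norm x powr (2 * v)" for v
    using R by (simp add: powr_powr flip: powr_numeral)
  have m: "0 \<le> ?m" using t by simp
  show ?thesis
  proof (cases "(norm x)\<^sup>2 \<le> t")
    case True
    have "?d = ((norm x)\<^sup>2) powr (real ?n / 2 + s)"
      by (simp add: sq distrib_left)
    also have "\<dots> \<le> t powr (real ?n / 2 + s)"
      using True s by (intro powr_mono2) auto
    finally have "t powr (- real ?n / 2) * ?d \<le> t powr (- real ?n / 2) * t powr (real ?n / 2 + s)"
      by (intro mult_left_mono) auto
    also have "\<dots> = t powr s"
      by (simp add: powr_add[symmetric])
    finally have "t powr (- real ?n / 2) \<le> t powr s / ?d"
      using d(2) by (simp add: pos_le_divide_eq)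
    also have "\<dots> \<le> ?m"
      by (intro divide_right_mono) auto
    finally have "sqrt pi ^ ?n * t powr (- real ?n / 2) \<le> sqrt pi ^ ?n * ?m"
      by (intro mult_left_mono) auto
    also have "\<dots> \<le> C * ?m"
      using m by (intro mult_right_mono) (auto simp: C_def)
    finally show ?thesis
      using stable_kernel_le_gauss_diagonal[OF t, of x] by simp
  next
    case False
    let ?C = "real (Suc ?n) ^ Suc ?n"
    have "exp (- (t / (norm x)\<^sup>2)) * exp (- (t * (1 / (norm x)\<^sup>2) powr s))
        = exp (- (t / (norm x)\<^sup>2 + t / norm x powr (2 * s)))"
      using R by (simp add: exp_add[symmetric] powr_divide sq)
    also have "1 - \<dots> \<le> t / (norm x)\<^sup>2 + t / norm x powr (2 * s)"
      using exp_ge_add_one_self[of "- (t / (norm x)\<^sup>2 + t / norm x powr (2 * s))"] by linarith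
    finally have 1: "1 - exp (- (t / (norm x)\<^sup>2)) * exp (- (t * (1 / (norm x)\<^sup>2) powr s))
        \<le> t / (norm x)\<^sup>2 + t / norm x powr (2 * s)" by simp
    have "t / (norm x)\<^sup>2 = (t / (norm x)\<^sup>2) powr 1"
      using t by simp
    also have "\<dots> \<le> (t / (norm x)\<^sup>2) powr s"
      using False R t s by (intro powr_mono') (auto simp: pos_divide_le_eq)
    also have "\<dots> = t powr s / norm x powr (2 * s)"
      using t by (simp add: powr_divide sq)
    finally have 2: "t / (norm x)\<^sup>2 \<le> t powr s / norm x powr (2 * s)" .
    have "norm x ^ ?n * stable_kernel s t x
        \<le> ?C * (1 - exp (- (t / (norm x)\<^sup>2)) * exp (- (t * (1 / (norm x)\<^sup>2) powr s)))"
      unfolding stable_kernel_def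
      using damped_fourier_le_tail[OF t x exp_mixture_stable[OF s, of t]] t s by simp
    also have "\<dots> \<le> ?C * (2 * (max t (t powr s) / norm x powr (2 * s)))"
    proof (rule mult_left_mono)
      have "t / norm x powr (2 * s) \<le> max t (t powr s) / norm x powr (2 * s)"
        "t powr s / norm x powr (2 * s) \<le> max t (t powr s) / norm x powr (2 * s)"
        by (intro divide_right_mono; simp)+
      with 1 2 show "1 - exp (- (t / (norm x)\<^sup>2)) * exp (- (t * (1 / (norm x)\<^sup>2) powr s))
          \<le> 2 * (max t (t powr s) / norm x powr (2 * s))"
        by linarith
    qed simp
    finally have "stable_kernel s t x \<le> (2 * ?C) * ?m"
      using R d by (simp add: field_simps del: power_Suc of_nat_Suc)
    also have "\<dots> \<le> C * ?m"
      using m by (intro mult_right_mono) (auto simp: C_def)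
    finally show ?thesis .
  qed
qed

text \<open>At u = n / (2 t) one has t u^s = (n/2)^s t^(1-s), which is at most (n/2)^s because t <=
  1.\<close>

lemma stable_kernel_ge_diagonal:
  fixes x :: "'a::euclidean_space"
  assumes t: "0 < t" "t \<le> 1" and x: "(norm x)\<^sup>2 \<le> t"
  defines "c \<equiv> exp (- pi\<^sup>2) * sqrt pi ^ DIM('a) * exp (- ((real DIM('a) / 2) powr s))"
  shows "c * t powr (- real DIM('a) / 2) \<le> stable_kernel s t x"
proof -
  let ?n = "DIM('a)"
  have "t * (real ?n / (2 * t)) powr s = (real ?n / 2) powr s * (t powr 1 * t powr (- s))"
    using t by (simp add: powr_divide powr_mult powr_minus field_simps)
  also have "\<dots> = (real ?n / 2) powr s * t powr (1 - s)"
    by (simp only: powr_add[symmetric]) simp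
  also have "\<dots> \<le> (real ?n / 2) powr s * 1"
    using t s by (intro mult_left_mono) (auto intro: powr_le1)
  finally have "exp (- ((real ?n / 2) powr s)) \<le> exp (- (t * (real ?n / (2 * t)) powr s))"
    by simp
  then have "exp (- pi\<^sup>2) * sqrt (pi / t) ^ ?n * exp (- ((real ?n / 2) powr s))
      \<le> exp (- pi\<^sup>2) * sqrt (pi / t) ^ ?n * exp (- (t * (real ?n / (2 * t)) powr s))"
    using t by (intro mult_left_mono) auto
  also have "\<dots> \<le> stable_kernel s t x"
    unfolding stable_kernel_def
    using damped_fourier_ge_diagonal[OF t(1) x exp_mixture_stable[OF s, of t]] t by simp
  finally show ?thesis
    using t by (simp add: c_def sqrt_divide_power mult_ac)
qed

text \<open>Expanding in \<epsilon>, the second difference contributes D \<epsilon>, and \<delta> is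
  chosen so that the subtracted first difference takes half of it. The quadratic error (2 (2^s)^2 +
  \<delta>) \<epsilon>^2 takes at most another quarter by the bound on \<epsilon>.\<close>

lemma second_difference_exp_ge:
  fixes \<delta> \<epsilon> D :: real
  defines "D \<equiv> 2 * 2 powr s - 1 - 3 powr s"
  defines "\<delta> \<equiv> D / (2 * (2 powr s - 1))"
  assumes \<epsilon>: "0 \<le> \<epsilon>" "\<epsilon> \<le> D / (4 * (2 * (2 powr s)\<^sup>2 + \<delta>))"
  shows "D / 4 * \<epsilon> \<le> (exp (- \<epsilon>) - 2 * exp (- (2 powr s * \<epsilon>)) + exp (- (3 powr s * \<epsilon>)))
                        - \<delta> * (exp (- \<epsilon>) - exp (- (2 powr s * \<epsilon>)))"
proof -
  define p q where "p = (2::real) powr s" and "q = (3::real) powr s"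
  have p: "1 < p" unfolding p_def using s by simp
  have D: "0 < D" "D = 2 * p - 1 - q"
    using powr_concave_strict[OF s] by (simp_all add: D_def p_def q_def)
  have \<delta>: "0 < \<delta>" "\<delta> * (p - 1) = D / 2"
    using D(1) p unfolding \<delta>_def p_def[symmetric] by (simp, simp add: nonzero_divide_eq_eq)
  have "\<epsilon> * (2 * p\<^sup>2 + \<delta>) \<le> D / 4"
  proof -
    have "0 < 2 * p\<^sup>2 + \<delta>" using p \<delta> by (simp add: add_pos_pos)
    then show ?thesis using \<epsilon>(2) unfolding p_def[symmetric] by (simp add: pos_le_divide_eq algebra_simps)
  qed
  then have "(\<epsilon> * (2 * p\<^sup>2 + \<delta>)) * \<epsilon> \<le> D / 4 * \<epsilon>"
    using \<epsilon>(1) by (rule mult_right_mono)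
  moreover have "(\<delta> * (p - 1)) * \<epsilon> = D / 2 * \<epsilon>"
    by (simp only: \<delta>(2))
  moreover have "(1 - \<epsilon>) - 2 * (1 - p * \<epsilon> + (p * \<epsilon>)\<^sup>2) + (1 - q * \<epsilon>) - \<delta> * ((1 - \<epsilon> + \<epsilon>\<^sup>2) - (1 - p * \<epsilon>))
      = D * \<epsilon> - (\<epsilon> * (2 * p\<^sup>2 + \<delta>)) * \<epsilon> - (\<delta> * (p - 1)) * \<epsilon>"
    unfolding D(2) by (simp add: power2_eq_square algebra_simps)
  ultimately have "D / 4 * \<epsilon> \<le> (1 - \<epsilon>) - 2 * (1 - p * \<epsilon> + (p * \<epsilon>)\<^sup>2) + (1 - q * \<epsilon>)
      - \<delta> * ((1 - \<epsilon> + \<epsilon>\<^sup>2) - (1 - p * \<epsilon>))"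
    by linarith
  also have "\<dots> \<le> (exp (- \<epsilon>) - 2 * exp (- (p * \<epsilon>)) + exp (- (q * \<epsilon>))) - \<delta> * (exp (- \<epsilon>) - exp (- (p * \<epsilon>)))"
  proof -
    have "1 - \<epsilon> \<le> exp (- \<epsilon>)" "1 - p * \<epsilon> \<le> exp (- (p * \<epsilon>))" "1 - q * \<epsilon> \<le> exp (- (q * \<epsilon>))"
      using exp_ge_add_one_self[of "- \<epsilon>"] exp_ge_add_one_self[of "- (p * \<epsilon>)"]
        exp_ge_add_one_self[of "- (q * \<epsilon>)"] by linarith+
    moreover have "exp (- \<epsilon>) \<le> 1 - \<epsilon> + \<epsilon>\<^sup>2" "exp (- (p * \<epsilon>)) \<le> 1 - p * \<epsilon> + (p * \<epsilon>)\<^sup>2"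
      using exp_minus_le_quadratic \<epsilon>(1) p by simp_all
    ultimately show ?thesis
      using \<delta>(1) by (intro diff_mono add_mono mult_left_mono) auto
  qed
  finally show ?thesis by (simp only: p_def q_def)
qed

lemma stable_kernel_ge_tail:
  obtains c where "0 < c"
    "\<And>t x. 1 < t \<Longrightarrow> t < norm (x::'a::euclidean_space) powr (2 * s) \<Longrightarrow>
       c * (t / norm x powr (real DIM('a) + 2 * s)) \<le> stable_kernel s t x"
proof -
  let ?n = "DIM('a)"
  define D where "D = 2 * 2 powr s - 1 - 3 powr s"
  define \<delta> where "\<delta> = D / (2 * (2 powr s - 1))"
  define \<epsilon>0 where "\<epsilon>0 = D / (4 * (2 * (2 powr s)\<^sup>2 + \<delta>))"
  \<comment> \<open>Chosen so that \<open>K powr s\<close> is 1 / \<epsilon>0: at a = 1 / (K |x|^2)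
    this gives t a^s = \<epsilon>0 t / |x|^(2s), below \<epsilon>0 exactly when t <
    |x|^(2s).\<close>
  define K where "K = \<epsilon>0 powr (- (1 / s))"
  define c where "c = sqrt (1 / (1 + K * real ?n / 2)) ^ ?n * exp (- (pi\<^sup>2 / (K * \<delta>)))"
  have D: "0 < D" using powr_concave_strict[OF s] by (simp add: D_def)
  have \<delta>: "0 < \<delta>"
    unfolding \<delta>_def using D s by (intro divide_pos_pos) auto
  have \<epsilon>0: "0 < \<epsilon>0"
    unfolding \<epsilon>0_def using D \<delta> by (intro divide_pos_pos mult_pos_pos add_pos_pos) auto
  have K: "0 < K" "K powr s = 1 / \<epsilon>0"
    using \<epsilon>0 s unfolding K_def powr_powr by (simp_all add: powr_minus_divide)
  have c: "0 < c"
    using K by (auto simp: c_def intro!: mult_pos_pos zero_less_power add_pos_nonneg)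
  have "c * (D / 4) * \<epsilon>0 * (t / norm x powr (real ?n + 2 * s)) \<le> stable_kernel s t x"
    if t: "1 < t" "t < norm x powr (2 * s)" for t and x :: 'a
  proof -
    let ?f = "\<lambda>u. exp (- (t * u powr s))"
    \<comment> \<open>Here t > 1 matters: it forces |x| > 1, hence t < |x|^(2s) <= |x|^2, as the
      general tail estimate requires.\<close>
    have R1: "1 < norm x"
    proof (rule ccontr)
      assume "\<not> 1 < norm x"
      then have "norm x powr (2 * s) \<le> 1" using s by (intro powr_le1) auto
      with t show False by simp
    qed
    then have "norm x powr (2 * s) \<le> norm x powr 2"
      using s by (intro powr_mono) auto
    with t R1 have t2: "t \<le> (norm x)\<^sup>2" by simp
    have sq: "((norm x)\<^sup>2) powr s = norm x powr (2 * s)"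
      using R1 by (simp add: powr_powr flip: powr_numeral)
    define a where "a = 1 / (K * (norm x)\<^sup>2)"
    define \<epsilon> where "\<epsilon> = t * a powr s"
    have a: "0 < a" using K(1) R1 unfolding a_def by (intro divide_pos_pos mult_pos_pos) auto
    have \<epsilon>: "\<epsilon> = \<epsilon>0 * (t / norm x powr (2 * s))"
      using K R1 by (simp add: \<epsilon>_def a_def powr_divide powr_mult sq)
    have "t / norm x powr (2 * s) \<le> 1" using t by (intro divide_le_eq_1[THEN iffD2]) auto
    then have "\<epsilon> \<le> \<epsilon>0" unfolding \<epsilon> using \<epsilon>0 by (intro mult_left_le) auto
    have "0 \<le> \<epsilon>" using t by (simp add: \<epsilon>_def)
    have f: "?f a = exp (- \<epsilon>)" "?f (2 * a) = exp (- (2 powr s * \<epsilon>))" "?f (3 * a) = exp (- (3 powr s * \<epsilon>))"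
      using a by (simp_all add: \<epsilon>_def powr_mult mult_ac)
    have "c * (D / 4 * \<epsilon>) \<le> c * ((?f a - 2 * ?f (2 * a) + ?f (3 * a)) - \<delta> * (?f a - ?f (2 * a)))"
      unfolding f D_def \<delta>_def using c \<open>0 \<le> \<epsilon>\<close> \<open>\<epsilon> \<le> \<epsilon>0\<close>
      by (intro mult_left_mono second_difference_exp_ge) (auto simp: D_def \<delta>_def \<epsilon>0_def)
    also have "\<dots> \<le> norm x ^ ?n * stable_kernel s t x"
      unfolding stable_kernel_def c_def a_def
      using t t2 K(1) \<delta> exp_mixture_stable[OF s] by (intro damped_fourier_ge_tail) auto
    finally have le: "c * (D / 4 * \<epsilon>) \<le> stable_kernel s t x * norm x ^ ?n"
      by (simp only: mult.commute)
    have R: "0 < norm x ^ ?n"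
      using R1 by (intro zero_less_power) linarith
    from le have "c * (D / 4 * \<epsilon>) / norm x ^ ?n \<le> stable_kernel s t x"
      using R by (simp only: pos_divide_le_eq)
    then have "c * (D / 4) * \<epsilon>0 * (t / norm x powr (2 * s)) / norm x ^ ?n \<le> stable_kernel s t x"
      by (simp add: \<epsilon>)
    moreover have "norm x powr (real ?n + 2 * s) = norm x powr (2 * s) * norm x ^ ?n"
      using powr_realpow[of "norm x" ?n] R1 by (auto simp: powr_add)
    ultimately show ?thesis by simp
  qed
  moreover have "0 < c * (D / 4) * \<epsilon>0" using c D \<epsilon>0 by simp
  ultimately show thesis using that by blast
qed

end

section \<open>Assembly for the heat kernel\<close>

theorem theorem3p1:
  fixes s :: real
  assumes "0 < s" and "s < 1"
  shows
    "(\<forall>t>0.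
        (\<forall>x :: real ^ 'n. heat_kernel s x t \<in> \<real>\<^sub>\<ge>\<^sub>0) \<and>
        (\<forall>(x :: real ^ 'n) (y :: real ^ 'n). norm x = norm y \<longrightarrow> heat_kernel s x t = heat_kernel s y t) \<and>
        (\<forall>(x :: real ^ 'n) (y :: real ^ 'n). norm x \<le> norm y \<longrightarrow>
            Re (heat_kernel s y t) \<le> Re (heat_kernel s x t))) \<and>
     (\<exists>(C1 :: real) (C2 :: real). C1 > 0 \<and> C2 > 0 \<and>
        (\<forall>(x :: real ^ 'n) (t :: real). t > 0 \<longrightarrow>
            ereal (Re (heat_kernel s x t))
              \<le> ereal C1 * min (tail_bound s x t)
                  (ereal (min (t powr (- real CARD('n) / (2 * s)))
                              (t powr (- real CARD('n) / 2)))) \<and>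
            (1 < t \<and> t < norm x powr (2 * s) \<longrightarrow>
              Re (heat_kernel s x t) \<ge> C2 * (t / norm x powr (real CARD('n) + 2 * s))) \<and>
            ((norm x)\<^sup>2 < t \<and> t < norm x powr (2 * s) \<and> norm x powr (2 * s) < 1 \<longrightarrow>
              Re (heat_kernel s x t)
                \<ge> C2 * (exp (- (pi * (norm x)\<^sup>2 / t)) * t powr (- real CARD('n) / 2)))))"
proof -
  let ?n = "CARD('n)"
  note s = assms
  have mix: "exp_mixture (\<lambda>u. exp (- (t * u powr s)))" if "0 < t" for t
    using exp_mixture_stable[OF s] that by simp
  have dim: "DIM(real ^ 'n) = ?n" by simp
  have Re: "Re (heat_kernel s x t) = stable_kernel s t x" for x :: "real ^ 'n" and t
    by (simp add: heat_kernel_eq_damped_fourier stable_kernel_def)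
  have Im: "Im (heat_kernel s x t) = 0" if "0 < t" for x :: "real ^ 'n" and t
    using damped_fourier_real[OF that mix[OF that]] by (simp add: heat_kernel_eq_damped_fourier)
  have mono: "Re (heat_kernel s y t) \<le> Re (heat_kernel s x t)" if "0 < t" "norm x \<le> norm y"
    for x y :: "real ^ 'n" and t
    using damped_fourier_antimono[OF that mix[OF that(1)]] by (simp add: heat_kernel_eq_damped_fourier)
  have nonneg: "heat_kernel s x t \<in> \<real>\<^sub>\<ge>\<^sub>0" if "0 < t" for x :: "real ^ 'n" and t
    using damped_fourier_nonneg[OF that mix[OF that]] Im[OF that, of x]
    by (simp add: complex_nonneg_Reals_iff heat_kernel_eq_damped_fourier)
  have radial: "heat_kernel s x t = heat_kernel s y t" if "0 < t" "norm x = norm y"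
    for x y :: "real ^ 'n" and t
    using mono[OF that(1), of x y] mono[OF that(1), of y x] Im[OF that(1)] that(2)
    by (intro complex_eqI) auto

  obtain D where D: "0 < D"
    "\<And>t x. 0 < t \<Longrightarrow> stable_kernel s t (x :: real ^ 'n) \<le> D * t powr (- real ?n / (2 * s))"
    using stable_kernel_le_stable_diagonal[OF s, where 'a = "real ^ 'n"] unfolding dim by blast
  define A where "A = sqrt pi ^ ?n + 2 * real (Suc ?n) ^ Suc ?n"
  define C1 where "C1 = A + D"
  have A: "0 < A" "sqrt pi ^ ?n \<le> A" by (auto simp: A_def intro!: add_pos_pos)
  then have C1: "0 < C1" "A \<le> C1" "D \<le> C1" using D(1) by (auto simp: C1_def)
  obtain c where c: "0 < c" "\<And>t x. 1 < t \<Longrightarrow> t < norm (x :: real ^ 'n) powr (2 * s) \<Longrightarrow>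
       c * (t / norm x powr (real ?n + 2 * s)) \<le> stable_kernel s t x"
    using stable_kernel_ge_tail[OF s, where 'a = "real ^ 'n"] unfolding dim by blast
  define b where "b = exp (- pi\<^sup>2) * sqrt pi ^ ?n * exp (- ((real ?n / 2) powr s))"
  define C2 where "C2 = min b c"
  have C2: "0 < C2" "C2 \<le> b" "C2 \<le> c" using c(1) by (auto simp: C2_def b_def)

  have upper: "ereal (Re (heat_kernel s x t)) \<le> ereal C1 * min (tail_bound s x t)
      (ereal (min (t powr (- real ?n / (2 * s))) (t powr (- real ?n / 2))))"
    if t: "0 < t" for x :: "real ^ 'n" and t
  proof -
    let ?m = "min (t powr (- real ?n / (2 * s))) (t powr (- real ?n / 2))"
    have "stable_kernel s t x \<le> sqrt pi ^ ?n * t powr (- real ?n / 2)"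
      using stable_kernel_le_gauss_diagonal[OF s t, of x] unfolding dim .
    also have "\<dots> \<le> C1 * t powr (- real ?n / 2)"
      using A C1 by (intro mult_right_mono) auto
    finally have 1: "stable_kernel s t x \<le> C1 * t powr (- real ?n / 2)" .
    have "stable_kernel s t x \<le> D * t powr (- real ?n / (2 * s))"
      by (rule D(2)[OF t])
    also have "\<dots> \<le> C1 * t powr (- real ?n / (2 * s))"
      using C1 by (intro mult_right_mono) auto
    finally have 2: "stable_kernel s t x \<le> C1 * ?m"
      using 1 by (simp add: min_def)
    show ?thesis
    proof (cases "x = 0")
      case True
      \<comment> \<open>At x = 0 the tail bound is infinite, so the minimum is the diagonal
        bound.\<close>
      then show ?thesis using t 2 by (simp add: tail_bound_zero Re del: ereal_min)
    next
      case False
      let ?d = "norm x powr (real ?n + 2 * s)"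
      have d: "0 < ?d" using False by simp
      have "tail_bound s x t = ereal (max t (t powr s) / ?d)"
        using d by (simp add: tail_bound_def max_def divide_right_mono divide_le_cancel)
      moreover have "stable_kernel s t x \<le> A * (max t (t powr s) / ?d)"
        using stable_kernel_le_tail[OF s t False] unfolding dim A_def .
      moreover have "\<dots> \<le> C1 * (max t (t powr s) / ?d)"
        using C1 t by (intro mult_right_mono) auto
      ultimately show ?thesis
        using 2 by (simp add: Re min_def)
    qed
  qed
  have lower1: "C2 * (t / norm x powr (real ?n + 2 * s)) \<le> Re (heat_kernel s x t)"
    if "1 < t" "t < norm x powr (2 * s)" for x :: "real ^ 'n" and t
  proof -
    have "C2 * (t / norm x powr (real ?n + 2 * s)) \<le> c * (t / norm x powr (real ?n + 2 * s))"
      using C2 that by (intro mult_right_mono) auto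
    with c(2)[OF that] show ?thesis by (simp add: Re)
  qed
  have lower2: "C2 * (exp (- (pi * (norm x)\<^sup>2 / t)) * t powr (- real ?n / 2)) \<le> Re (heat_kernel s x t)"
    if "0 < t" "(norm x)\<^sup>2 < t" "t < norm x powr (2 * s)" "norm x powr (2 * s) < 1"
    for x :: "real ^ 'n" and t
  proof -
    \<comment> \<open>The exponential is bounded by 1; the kernel is bounded below by a multiple of
      t^(-n/2) alone in this region.\<close>
    have "C2 * (exp (- (pi * (norm x)\<^sup>2 / t)) * t powr (- real ?n / 2)) \<le> b * (1 * t powr (- real ?n / 2))"
      using C2 that by (intro mult_mono) auto
    also have "\<dots> \<le> stable_kernel s t x"
      using stable_kernel_ge_diagonal[OF s, of t x] that unfolding dim b_def by simp
    finally show ?thesis by (simp add: Re)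
  qed
  show ?thesis
    by (rule conjI, intro allI impI conjI, rule nonneg, assumption, rule radial, assumption, assumption,
        rule mono, assumption, assumption, rule exI[of _ C1], rule exI[of _ C2],
        intro conjI allI impI, rule C1(1), rule C2(1), rule upper, assumption)
       (elim conjE, rule lower1, assumption+, elim conjE, rule lower2, assumption+)
qed

end
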